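(* The eigenvalues of the action of $t$ on $H^1(U, V)$ are $\epsilon ^{l_1+2}(\epsilon ^{\prime})^{-l_2}$ and $\epsilon ^{-l_1-2}(\epsilon ^{\prime})^{l_2}$. In particular, $H^1(U, V)^{P/U}=0$.
   Context: Let $F$ be a real quadratic field with ring of integers $\mathcal O_F=\mathbf Z+\mathbf Z\omega$, let $\epsilon$ be the fundamental unit of $F$, and for $x\in F$ let $x'$ denote its Galois conjugate. Let $\Gamma={\rm PSL}(2,\mathcal O_F)$ and define the subgroups $P=\{\begin{pmatrix} t & 0\\ u & t^{-1}\end{pmatrix} : t\in\mathcal O_F^{\times}, u\in\mathcal O_F\}/\{\pm 1_2\}$ and $U=\{\begin{pmatrix} \pm1 & 0\\ u & \pm1\end{pmatrix} : u\in\mathcal O_F\}/\{\pm 1_2\}$. Put $t=\begin{pmatrix} \epsilon^{-1} & 0\\ 0 & \epsilon\end{pmatrix}\in P$; $P/U$ is infinite cyclic generated by the class of $t$. Let $l_1\ge l_2\ge 0$ be integers with $l_1\equiv l_2 \bmod 2$. For $l\ge0$ let $\rho_l$ be the symmetric tensor representation of ${\rm GL}(2,\mathbf C)$ of degree $l$ on $\mathbf C^{l+1}$, defined by $\rho_l(g){}^t(u^l, u^{l-1}v,\dots,v^l)={}^t(u'^l,\dots,v'^l)$ where ${}^t(u',v')=g\,{}^t(u,v)$. Let $V=V_1\otimes V_2$ with $V_i=\mathbf C^{l_i+1}$, on which $\gamma\in\Gamma$ acts by $\rho_{l_1}(\gamma)\otimes\rho_{l_2}(\gamma')$, $\gamma'$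 being the Galois conjugate matrix. The action of $t$ on $H^q(U,V)$ is induced by sending a cocycle $f$ to $(n_1,\dots,n_q)\mapsto t^{-1}f(tn_1t^{-1},\dots,tn_qt^{-1})$. *)

theory Defs
  imports
    "HOL-Library.Function_Algebras"
    "HOL-Number_Theory.Cong"
    "HOL-Algebra.Coset"
    "Jordan_Normal_Form.Determinant"
begin

section \<open>Real quadratic fields\<close>

text \<open>A real quadratic field is taken together with one of its embeddings into the reals, i.e. as a
  subfield of the reals of degree 2 over the rationals.\<close>

definition real_quadratic_field :: "real set \<Rightarrow> bool" where
  "real_quadratic_field F \<longleftrightarrow>
     1 \<in> F \<and> (\<forall>x\<in>F. \<forall>y\<in>F. x - y \<in> F \<and> x * y \<in> F) \<and> (\<forall>x\<in>F. inverse x \<in> F) \<and>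
     vector_space.dim (\<lambda>(q::rat) (x::real). of_rat q * x) F = 2"

definition ring_of_integers :: "real set \<Rightarrow> real set" where
  "ring_of_integers F = {x \<in> F. algebraic_int x}"

definition integer_units :: "real set \<Rightarrow> real set" where
  "integer_units F = {x \<in> ring_of_integers F. \<exists>y \<in> ring_of_integers F. x * y = 1}"

definition fundamental_unit :: "real set \<Rightarrow> real \<Rightarrow> bool" where
  "fundamental_unit F e \<longleftrightarrow>
     e \<in> integer_units F \<and> e > 1 \<and>
     (\<forall>x \<in> integer_units F. \<exists>n::int. x = e powi n \<or> x = - (e powi n))"

text \<open>The values of \<open>c\<close> outside \<open>F\<close> are irrelevant; \<open>\<rat>\<close> is fixed automatically.\<close>

definition galois_conjugation :: "real set \<Rightarrow> (real \<Rightarrow> real) \<Rightarrow> bool" where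
  "galois_conjugation F c \<longleftrightarrow>
     bij_betw c F F \<and>
     (\<forall>x\<in>F. \<forall>y\<in>F. c (x + y) = c x + c y \<and> c (x * y) = c x * c y) \<and>
     (\<exists>x\<in>F. c x \<noteq> x)"


section \<open>The groups\<close>

definition mat22 :: "'a \<Rightarrow> 'a \<Rightarrow> 'a \<Rightarrow> 'a \<Rightarrow> 'a mat" where
  "mat22 a b c d = mat_of_rows_list 2 [[a, b], [c, d]]"

definition SL2 :: "real set \<Rightarrow> real mat monoid" where
  "SL2 R = \<lparr>carrier = {A \<in> carrier_mat 2 2. elements_mat A \<subseteq> R \<and> det A = 1},
            monoid.mult = (*), one = 1\<^sub>m 2\<rparr>"

definition pm_one :: "real mat set" where
  "pm_one = {1\<^sub>m 2, - 1\<^sub>m 2}"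

definition PSL2 :: "real set \<Rightarrow> real mat set monoid" where
  "PSL2 R = SL2 R Mod pm_one"

definition psl_class :: "real set \<Rightarrow> real mat \<Rightarrow> real mat set" where
  "psl_class R A = pm_one #>\<^bsub>SL2 R\<^esub> A"

definition grp_P :: "real set \<Rightarrow> real mat set set" where
  "grp_P F = {psl_class (ring_of_integers F) (mat22 t 0 u (inverse t)) | t u.
                t \<in> integer_units F \<and> u \<in> ring_of_integers F}"

definition grp_U :: "real set \<Rightarrow> real mat set set" where
  "grp_U F = {psl_class (ring_of_integers F) (mat22 s 0 u s) | s u.
                s \<in> {1, -1} \<and> u \<in> ring_of_integers F}"

definition elem_t :: "real set \<Rightarrow> real \<Rightarrow> real mat set" where
  "elem_t F e = psl_class (ring_of_integers F) (mat22 (inverse e) 0 0 e)"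


section \<open>The representation\<close>

definition monomial_vec :: "nat \<Rightarrow> complex \<Rightarrow> complex \<Rightarrow> complex vec" where
  "monomial_vec l u v = vec (l + 1) (\<lambda>i. u ^ (l - i) * v ^ i)"

definition sym_rep :: "nat \<Rightarrow> complex mat \<Rightarrow> complex mat" where
  "sym_rep l g = (THE M. M \<in> carrier_mat (l + 1) (l + 1) \<and>
     (\<forall>u v. M *\<^sub>v monomial_vec l u v =
        monomial_vec l ((g *\<^sub>v vec_of_list [u, v]) $ 0) ((g *\<^sub>v vec_of_list [u, v]) $ 1)))"

lemma homogenize_linear_mult:
  fixes a b u v :: complex
  assumes "degree p \<le> m"
  shows "(\<Sum>j\<le>Suc m. coeff ([:a, b:] * p) j * (u ^ (Suc m - j) * v ^ j)) =
         (a * u + b * v) * (\<Sum>j\<le>m. coeff p j * (u ^ (m - j) * v ^ j))"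
proof -
  have c0: "coeff p (Suc m) = 0"
    using assms by (simp add: coeff_eq_0)
  have "(\<Sum>j\<le>Suc m. coeff ([:a, b:] * p) j * (u ^ (Suc m - j) * v ^ j)) =
        (\<Sum>j\<le>Suc m. a * coeff p j * (u ^ (Suc m - j) * v ^ j)) +
        (\<Sum>j\<le>Suc m. coeff (pCons 0 (smult b p)) j * (u ^ (Suc m - j) * v ^ j))"
    by (simp add: algebra_simps sum.distrib)
  also have "(\<Sum>j\<le>Suc m. a * coeff p j * (u ^ (Suc m - j) * v ^ j)) =
             (\<Sum>j\<le>m. a * coeff p j * (u ^ (Suc m - j) * v ^ j))"
    by (simp add: c0)
  also have "\<dots> = a * u * (\<Sum>j\<le>m. coeff p j * (u ^ (m - j) * v ^ j))"
    unfolding sum_distrib_left by (rule sum.cong) (auto simp: Suc_diff_le)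
  also have "(\<Sum>j\<le>Suc m. coeff (pCons 0 (smult b p)) j * (u ^ (Suc m - j) * v ^ j)) =
             b * v * (\<Sum>j\<le>m. coeff p j * (u ^ (m - j) * v ^ j))"
    by (subst sum.atMost_Suc_shift) (simp add: sum_distrib_left algebra_simps)
  finally show ?thesis
    by (simp add: algebra_simps)
qed

lemma homogenize_power_mult:
  fixes a b u v :: complex
  assumes "degree p \<le> m"
  shows "degree ([:a, b:] ^ n * p) \<le> n + m \<and>
         (\<Sum>j\<le>n + m. coeff ([:a, b:] ^ n * p) j * (u ^ (n + m - j) * v ^ j)) =
         (a * u + b * v) ^ n * (\<Sum>j\<le>m. coeff p j * (u ^ (m - j) * v ^ j))"
proof (induction n)
  case 0
  then show ?case using assms by simp
next
  case (Suc n)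
  let ?q = "[:a, b:] ^ n * p"
  have "degree ([:a, b:] * ?q) \<le> degree [:a, b:] + degree ?q"
    by (rule degree_mult_le)
  also have "\<dots> \<le> 1 + (n + m)"
    using Suc by (intro add_mono) auto
  finally have "degree ([:a, b:] * ?q) \<le> Suc n + m"
    by simp
  moreover have "[:a, b:] ^ Suc n * p = [:a, b:] * ?q"
    by (simp only: power_Suc mult.assoc)
  ultimately show ?case
    using homogenize_linear_mult[of ?q "n + m" a b u v] Suc by (simp only: add_Suc power_Suc mult.assoc)
qed

text \<open>The defining property of \<open>sym_rep\<close> determines a matrix, whose entry at \<open>(i, j)\<close> is the
  coefficient of \<open>u\<^bsup>l-j\<^esup> v\<^sup>j\<close> in \<open>(a u + b v)\<^bsup>l-i\<^esup> (c u + d v)\<^sup>i\<close>.\<close>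

lemma sym_rep_unique_eq:
  assumes "g \<in> carrier_mat 2 2"
  shows "\<exists>!M. M \<in> carrier_mat (l + 1) (l + 1) \<and>
     (\<forall>u v. M *\<^sub>v monomial_vec l u v =
        monomial_vec l ((g *\<^sub>v vec_of_list [u, v]) $ 0) ((g *\<^sub>v vec_of_list [u, v]) $ 1))"
    and "sym_rep l g = mat (l + 1) (l + 1) (\<lambda>(i, j).
       coeff ([:g $$ (0, 0), g $$ (0, 1):] ^ (l - i) * [:g $$ (1, 0), g $$ (1, 1):] ^ i) j)"
proof -
  let ?a = "g $$ (0, 0)" and ?b = "g $$ (0, 1)" and ?c = "g $$ (1, 0)" and ?d = "g $$ (1, 1)"
  let ?q = "\<lambda>i. [:?a, ?b:] ^ (l - i) * [:?c, ?d:] ^ i"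
  let ?M = "mat (l + 1) (l + 1) (\<lambda>(i, j). coeff (?q i) j)"
  let ?P = "\<lambda>M. M \<in> carrier_mat (l + 1) (l + 1) \<and>
     (\<forall>u v. M *\<^sub>v monomial_vec l u v =
        monomial_vec l ((g *\<^sub>v vec_of_list [u, v]) $ 0) ((g *\<^sub>v vec_of_list [u, v]) $ 1))"
  have g0: "(g *\<^sub>v vec_of_list [u, v]) $ 0 = ?a * u + ?b * v"
    and g1: "(g *\<^sub>v vec_of_list [u, v]) $ 1 = ?c * u + ?d * v" for u v
    using assms by (auto simp: scalar_prod_def numeral_2_eq_2)
  have mv: "(M *\<^sub>v monomial_vec l u v) $ i = (\<Sum>j\<le>l. M $$ (i, j) * (u ^ (l - j) * v ^ j))"
    if "M \<in> carrier_mat (l + 1) (l + 1)" "i \<le> l" for M u v i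
    using that by (auto simp: scalar_prod_def monomial_vec_def atLeast0LessThan lessThan_Suc_atMost
        intro!: sum.cong)
  have dimmv: "dim_vec (M *\<^sub>v monomial_vec l u v) = l + 1"
    if "M \<in> carrier_mat (l + 1) (l + 1)" for M u v
    using that by simp
  have ex: "?P ?M"
  proof (intro conjI allI)
    fix u v
    show "?M *\<^sub>v monomial_vec l u v =
        monomial_vec l ((g *\<^sub>v vec_of_list [u, v]) $ 0) ((g *\<^sub>v vec_of_list [u, v]) $ 1)"
    proof (rule eq_vecI)
      fix i assume "i < dim_vec (monomial_vec l ((g *\<^sub>v vec_of_list [u, v]) $ 0)
        ((g *\<^sub>v vec_of_list [u, v]) $ 1))"
      then have i: "i \<le> l" by (simp add: monomial_vec_def)
      have 1: "degree ([:?c, ?d:] ^ i * 1) \<le> i + 0 \<and>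
         (\<Sum>j\<le>i + 0. coeff ([:?c, ?d:] ^ i * 1) j * (u ^ (i + 0 - j) * v ^ j)) =
         (?c * u + ?d * v) ^ i * (\<Sum>j\<le>0. coeff 1 j * (u ^ (0 - j) * v ^ j))"
        by (rule homogenize_power_mult) simp
      have "(\<Sum>j\<le>l. coeff (?q i) j * (u ^ (l - j) * v ^ j)) =
            (?a * u + ?b * v) ^ (l - i) * (?c * u + ?d * v) ^ i"
        using 1 homogenize_power_mult[of "[:?c, ?d:] ^ i" i ?a ?b "l - i" u v] i by simp
      moreover have "(?M *\<^sub>v monomial_vec l u v) $ i =
          (\<Sum>j\<le>l. coeff (?q i) j * (u ^ (l - j) * v ^ j))"
        using i by (subst mv) (auto intro!: sum.cong)
      ultimately show "(?M *\<^sub>v monomial_vec l u v) $ i =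
        monomial_vec l ((g *\<^sub>v vec_of_list [u, v]) $ 0) ((g *\<^sub>v vec_of_list [u, v]) $ 1) $ i"
        unfolding g0 g1 using i by (simp add: monomial_vec_def)
    qed (simp add: monomial_vec_def)
  qed simp
  have uniq: "M = ?M" if M: "?P M" for M
  proof (rule eq_matI)
    fix i j assume "i < dim_row ?M" "j < dim_col ?M"
    then have ij: "i \<le> l" "j \<le> l" by auto
    have "\<forall>v. (\<Sum>j\<le>l. M $$ (i, j) * v ^ j) = (\<Sum>j\<le>l. ?M $$ (i, j) * v ^ j)"
    proof
      fix v
      have "(M *\<^sub>v monomial_vec l 1 v) $ i = (?M *\<^sub>v monomial_vec l 1 v) $ i"
        using M ex by metis
      then show "(\<Sum>j\<le>l. M $$ (i, j) * v ^ j) = (\<Sum>j\<le>l. ?M $$ (i, j) * v ^ j)"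
        using mv[of M i 1 v] mv[of ?M i 1 v] M ij by simp
    qed
    then show "M $$ (i, j) = ?M $$ (i, j)"
      using polyfun_eq_coeffs[of "\<lambda>j. M $$ (i, j)" l "\<lambda>j. ?M $$ (i, j)"] ij by blast
  qed (use M in auto)
  show "\<exists>!M. ?P M"
    using ex uniq by (rule ex1I)
  show "sym_rep l g = ?M"
    unfolding sym_rep_def using ex uniq by (rule the_equality)
qed

text \<open>The tensor product of \<open>\<complex>\<^bsup>m+1\<^esup>\<close> and \<open>\<complex>\<^bsup>n+1\<^esup>\<close> in the basis of all \<open>e\<^sub>i \<otimes> e\<^sub>j\<close>: a tensor is
  its coordinate function, extended by 0 outside the index range.\<close>

definition tensor_space :: "nat \<Rightarrow> nat \<Rightarrow> (nat \<times> nat \<Rightarrow> complex) set" where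
  "tensor_space m n = {v. \<forall>i j. \<not> (i \<le> m \<and> j \<le> n) \<longrightarrow> v (i, j) = 0}"

definition tensor_act ::
  "complex mat \<Rightarrow> complex mat \<Rightarrow> (nat \<times> nat \<Rightarrow> complex) \<Rightarrow> nat \<times> nat \<Rightarrow> complex" where
  "tensor_act A B v = (\<lambda>(i, j).
     if i < dim_row A \<and> j < dim_row B
     then \<Sum>k<dim_col A. \<Sum>m<dim_col B. A $$ (i, k) * B $$ (j, m) * v (k, m) else 0)"

text \<open>An element of \<open>PSL\<^sub>2\<close> is a set \<open>{g, -g}\<close>; both representatives act in the same way
  when \<open>l\<^sub>1\<close> and \<open>l\<^sub>2\<close> have the same parity, and \<open>the_elem\<close> extracts the common value.\<close>

definition rep_V ::
  "(real \<Rightarrow> real) \<Rightarrow> nat \<Rightarrow> nat \<Rightarrow> real mat set \<Rightarrow> (nat \<times> nat \<Rightarrow> complex) \<Rightarrow> nat \<times> nat \<Rightarrow> complex" where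
  "rep_V c l\<^sub>1 l\<^sub>2 X v = the_elem ((\<lambda>g.
     tensor_act (sym_rep l\<^sub>1 (map_mat complex_of_real g))
                (sym_rep l\<^sub>2 (map_mat complex_of_real (map_mat c g))) v) ` X)"


section \<open>First group cohomology\<close>

text \<open>Here \<open>N\<close> is (the carrier of) a subgroup of \<open>G\<close>, and \<open>G\<close> acts linearly on the space \<open>V\<close> of
  complex-valued functions through \<open>a\<close>. Cochains are extensional functions on \<open>N\<close>, and
  cohomology classes are equivalence classes of cocycles modulo coboundaries.\<close>

definition cocycles1 ::
  "('g, 'r) monoid_scheme \<Rightarrow> 'g set \<Rightarrow> ('i \<Rightarrow> complex) set \<Rightarrow> ('g \<Rightarrow> ('i \<Rightarrow> complex) \<Rightarrow> 'i \<Rightarrow> complex)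
     \<Rightarrow> ('g \<Rightarrow> 'i \<Rightarrow> complex) set" where
  "cocycles1 G N V a =
     {f \<in> N \<rightarrow>\<^sub>E V. \<forall>x\<in>N. \<forall>y\<in>N. f (x \<otimes>\<^bsub>G\<^esub> y) = f x + a x (f y)}"

definition coboundaries1 ::
  "'g set \<Rightarrow> ('i \<Rightarrow> complex) set \<Rightarrow> ('g \<Rightarrow> ('i \<Rightarrow> complex) \<Rightarrow> 'i \<Rightarrow> complex)
     \<Rightarrow> ('g \<Rightarrow> 'i \<Rightarrow> complex) set" where
  "coboundaries1 N V a = {(\<lambda>x\<in>N. a x v - v) | v. v \<in> V}"

definition cohom_rel1 ::
  "('g, 'r) monoid_scheme \<Rightarrow> 'g set \<Rightarrow> ('i \<Rightarrow> complex) set \<Rightarrow> ('g \<Rightarrow> ('i \<Rightarrow> complex) \<Rightarrow> 'i \<Rightarrow> complex)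
     \<Rightarrow> (('g \<Rightarrow> 'i \<Rightarrow> complex) \<times> ('g \<Rightarrow> 'i \<Rightarrow> complex)) set" where
  "cohom_rel1 G N V a = {(f, h). f \<in> cocycles1 G N V a \<and> h \<in> cocycles1 G N V a \<and>
     (\<lambda>x\<in>N. f x - h x) \<in> coboundaries1 N V a}"

definition H1 ::
  "('g, 'r) monoid_scheme \<Rightarrow> 'g set \<Rightarrow> ('i \<Rightarrow> complex) set \<Rightarrow> ('g \<Rightarrow> ('i \<Rightarrow> complex) \<Rightarrow> 'i \<Rightarrow> complex)
     \<Rightarrow> ('g \<Rightarrow> 'i \<Rightarrow> complex) set set" where
  "H1 G N V a = cocycles1 G N V a // cohom_rel1 G N V a"

definition H1_zero ::
  "('g, 'r) monoid_scheme \<Rightarrow> 'g set \<Rightarrow> ('i \<Rightarrow> complex) set \<Rightarrow> ('g \<Rightarrow> ('i \<Rightarrow> complex) \<Rightarrow> 'i \<Rightarrow> complex)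
     \<Rightarrow> ('g \<Rightarrow> 'i \<Rightarrow> complex) set" where
  "H1_zero G N V a = cohom_rel1 G N V a `` {\<lambda>x\<in>N. 0}"

definition H1_scale ::
  "('g, 'r) monoid_scheme \<Rightarrow> 'g set \<Rightarrow> ('i \<Rightarrow> complex) set \<Rightarrow> ('g \<Rightarrow> ('i \<Rightarrow> complex) \<Rightarrow> 'i \<Rightarrow> complex)
     \<Rightarrow> complex \<Rightarrow> ('g \<Rightarrow> 'i \<Rightarrow> complex) set \<Rightarrow> ('g \<Rightarrow> 'i \<Rightarrow> complex) set" where
  "H1_scale G N V a z X = (\<Union>f\<in>X. cohom_rel1 G N V a `` {\<lambda>x\<in>N. \<lambda>i. z * f x i})"

text \<open>The map induced on classes by \<open>f \<mapsto> (n \<mapsto> p\<^sup>-\<^sup>1 f(p n p\<^sup>-\<^sup>1))\<close>, for \<open>p\<close> normalizing \<open>N\<close>.\<close>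

definition H1_act ::
  "('g, 'r) monoid_scheme \<Rightarrow> 'g set \<Rightarrow> ('i \<Rightarrow> complex) set \<Rightarrow> ('g \<Rightarrow> ('i \<Rightarrow> complex) \<Rightarrow> 'i \<Rightarrow> complex)
     \<Rightarrow> 'g \<Rightarrow> ('g \<Rightarrow> 'i \<Rightarrow> complex) set \<Rightarrow> ('g \<Rightarrow> 'i \<Rightarrow> complex) set" where
  "H1_act G N V a p X = (\<Union>f\<in>X. cohom_rel1 G N V a ``
     {\<lambda>n\<in>N. a (inv\<^bsub>G\<^esub> p) (f (p \<otimes>\<^bsub>G\<^esub> n \<otimes>\<^bsub>G\<^esub> inv\<^bsub>G\<^esub> p))})"

definition H1_eigenvalues ::
  "('g, 'r) monoid_scheme \<Rightarrow> 'g set \<Rightarrow> ('i \<Rightarrow> complex) set \<Rightarrow> ('g \<Rightarrow> ('i \<Rightarrow> complex) \<Rightarrow> 'i \<Rightarrow> complex)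
     \<Rightarrow> 'g \<Rightarrow> complex set" where
  "H1_eigenvalues G N V a p =
     {z. \<exists>X \<in> H1 G N V a. X \<noteq> H1_zero G N V a \<and> H1_act G N V a p X = H1_scale G N V a z X}"

text \<open>The invariants of \<open>P/N\<close>: a coset acts through any of its representatives.\<close>

definition H1_invariants ::
  "('g, 'r) monoid_scheme \<Rightarrow> 'g set \<Rightarrow> 'g set \<Rightarrow> ('i \<Rightarrow> complex) set
     \<Rightarrow> ('g \<Rightarrow> ('i \<Rightarrow> complex) \<Rightarrow> 'i \<Rightarrow> complex) \<Rightarrow> ('g \<Rightarrow> 'i \<Rightarrow> complex) set set" where
  "H1_invariants G P N V a =
     {X \<in> H1 G N V a. \<forall>C \<in> carrier (G\<lparr>carrier := P\<rparr> Mod N). \<forall>p\<in>C. H1_act G N V a p X = X}"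

end

theory Submission
  imports Defs "HOL-Library.Set_Algebras" "Jordan_Normal_Form.Char_Poly"
begin

text \<open>Identify \<open>U\<close> with the additive group of integers \<open>x\<close> of \<open>F\<close>. On
  \<open>V = \<complex>[X, Y]/(X\<^bsup>m+1\<^esup>, Y\<^bsup>n+1\<^esup>)\<close>, where \<open>(m, n) = (l\<^sub>1, l\<^sub>2)\<close>, the element \<open>x\<close> acts as multiplication by
  \<open>exp(x X + x' Y)\<close>. Every additive map from the integers of \<open>F\<close> to \<open>\<complex>\<close> is a unique combination of \<open>x\<close>
  and \<open>x'\<close>, so the lowest homogeneous part of a cocycle has the form \<open>x g + x' h\<close>; since \<open>U\<close> is
  commutative, \<open>X h = Y g\<close>. Hence it can be removed by subtracting a coboundary and multiples of the
  cocycles \<open>Y\<^sup>n (exp(x X) - 1)/X\<close> and \<open>X\<^sup>m (exp(x' Y) - 1)/Y\<close>, and by induction on the degree these two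
  span \<open>H\<^sup>1(U, V)\<close>. They are independent, as the coefficients of the powers of \<open>Y\<close> and of \<open>X\<close> in a
  coboundary show, and they are eigenvectors of \<open>t\<close> with the two asserted eigenvalues. As \<open>\<epsilon> > 1\<close> and
  \<open>\<epsilon> \<epsilon>' = \<plusminus>1\<close>, neither eigenvalue is 1.\<close>

section \<open>Algebraic integers\<close>

text \<open>The interpretation is kept local because its simp rule \<open>scale_scale\<close> loops with
  \<open>of_int_mult\<close>.\<close>

context
begin

interpretation int_module: Modules.module "\<lambda>k x. of_int k * x :: 'a :: comm_ring_1"
  by unfold_locales (simp_all add: algebra_simps)

lemma algebraic_int_eigenvalue:
  fixes z :: "'a :: field_char_0"
  assumes M: "M \<in> carrier_mat n n" and z: "eigenvalue (map_mat of_int M) z"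
  shows "algebraic_int z"
  unfolding algebraic_int_altdef_ipoly
proof (intro exI conjI)
  show "poly (map_poly of_int (char_poly M)) z = 0"
    using eigenvalue_root_char_poly[of "map_mat of_int M" n z] M z
    by (simp add: of_int_hom.char_poly_hom[OF M])
  show "lead_coeff (char_poly M) = 1"
    using degree_monic_char_poly[OF M] by simp
qed

lemma algebraic_int_if_span_stable:
  fixes z :: "'a :: field_char_0"
  assumes "finite S" "s\<^sub>0 \<in> S" "s\<^sub>0 \<noteq> 0"
    and stable: "\<And>s. s \<in> S \<Longrightarrow> z * s \<in> int_module.span S"
  shows "algebraic_int z"
proof -
  have "\<forall>s\<in>S. \<exists>c. z * s = (\<Sum>r\<in>S. of_int (c r) * r)"
    using stable by (auto simp: int_module.span_finite[OF \<open>finite S\<close>])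
  then obtain c where c: "\<And>s. s \<in> S \<Longrightarrow> z * s = (\<Sum>r\<in>S. of_int (c s r) * r)"
    by metis
  obtain h where h: "bij_betw h {0..<card S} S"
    using ex_bij_betw_nat_finite[OF \<open>finite S\<close>] by blast
  define n where "n = card S"
  define M where "M = mat n n (\<lambda>(i, j). c (h i) (h j))"
  have "map_mat of_int M *\<^sub>v vec n h = z \<cdot>\<^sub>v vec n h"
  proof (rule eq_vecI)
    fix i assume "i < dim_vec (z \<cdot>\<^sub>v vec n h)"
    then have i: "i < n" by simp
    have "(map_mat of_int M *\<^sub>v vec n h) $ i = (\<Sum>j = 0..<n. of_int (c (h i) (h j)) * h j)"
      using i by (simp add: M_def scalar_prod_def)
    also have "\<dots> = (\<Sum>r\<in>S. of_int (c (h i) r) * r)"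
      using sum.reindex_bij_betw[OF h] by (simp add: n_def)
    also have "\<dots> = z * h i"
      using c[of "h i"] bij_betwE[OF h] i by (simp add: n_def)
    finally show "(map_mat of_int M *\<^sub>v vec n h) $ i = (z \<cdot>\<^sub>v vec n h) $ i"
      using i by simp
  qed (simp add: M_def)
  moreover have "vec n h \<noteq> 0\<^sub>v n"
  proof -
    have "s\<^sub>0 \<in> h ` {0..<n}"
      using bij_betw_imp_surj_on[OF h] \<open>s\<^sub>0 \<in> S\<close> by (simp add: n_def)
    then obtain i where "i < n" "h i = s\<^sub>0" by auto
    then have "vec n h $ i \<noteq> 0\<^sub>v n $ i" using \<open>s\<^sub>0 \<noteq> 0\<close> by simp
    then show ?thesis by metis
  qed
  ultimately have "eigenvalue (map_mat of_int M) z"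
    by (auto simp: eigenvalue_def eigenvector_def M_def intro!: exI[of _ "vec n h"])
  moreover have "M \<in> carrier_mat n n" by (simp add: M_def)
  ultimately show ?thesis by (rule algebraic_int_eigenvalue[rotated])
qed

lemma algebraic_int_imp_span_stable:
  fixes x :: "'a :: field_char_0"
  assumes "algebraic_int x"
  obtains S where "finite S" "1 \<in> S" "\<And>s. s \<in> S \<Longrightarrow> x * s \<in> int_module.span S"
proof -
  obtain p where root: "poly (map_poly of_int p) x = 0" and monic: "lead_coeff p = 1"
    using assms unfolding algebraic_int_altdef_ipoly by blast
  define S where "S = (\<lambda>i. x ^ i) ` {..<degree p}"
  have base: "x ^ i \<in> int_module.span S" if "i < degree p" for i
    using that by (intro int_module.span_base) (simp add: S_def)
  have "degree p \<noteq> 0"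
  proof
    assume "degree p = 0"
    then have "p = [:1:]" using monic by (auto elim!: degree_eq_zeroE)
    with root show False by simp
  qed
  then have "1 \<in> S"
    by (auto simp: S_def intro!: image_eqI[where x = 0])
  have "0 = (\<Sum>i\<le>degree p. of_int (coeff p i) * x ^ i)"
    using root by (simp add: poly_altdef)
  also have "\<dots> = x ^ degree p + (\<Sum>i<degree p. of_int (coeff p i) * x ^ i)"
    using monic by (simp flip: lessThan_Suc_atMost)
  finally have "x ^ degree p = - (\<Sum>i<degree p. of_int (coeff p i) * x ^ i)"
    by (simp add: eq_neg_iff_add_eq_0)
  also have "\<dots> \<in> int_module.span S"
    by (intro int_module.span_neg int_module.span_sum int_module.span_scale base) simp
  finally have top: "x ^ degree p \<in> int_module.span S" .
  have "x * s \<in> int_module.span S" if "s \<in> S" for s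
  proof -
    obtain i where "s = x ^ i" "i < degree p" using \<open>s \<in> S\<close> by (auto simp: S_def)
    then show ?thesis using top base[of "Suc i"]
      by (cases "Suc i = degree p") (simp_all flip: power_Suc)
  qed
  with \<open>1 \<in> S\<close> show ?thesis by (intro that[of S]) (simp_all add: S_def)
qed

lemma int_span_stable_set_times:
  assumes "finite S" and x: "\<And>s. s \<in> S \<Longrightarrow> x * s \<in> int_module.span S" and u: "u \<in> S * T"
  shows "x * u \<in> int_module.span (S * T)"
proof -
  obtain s t where st: "u = s * t" "s \<in> S" "t \<in> T" using u by (auto elim: set_times_elim)
  obtain c where "x * s = (\<Sum>r\<in>S. of_int (c r) * r)"
    using x[OF \<open>s \<in> S\<close>] by (auto simp: int_module.span_finite[OF \<open>finite S\<close>])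
  then have "x * u = (\<Sum>r\<in>S. of_int (c r) * (r * t))"
    by (simp add: st sum_distrib_right flip: mult.assoc)
  also have "\<dots> \<in> int_module.span (S * T)"
    using \<open>t \<in> T\<close>
    by (intro int_module.span_sum int_module.span_scale int_module.span_base set_times_intro)
  finally show ?thesis .
qed

lemma
  fixes x y :: "'a :: field_char_0"
  assumes "algebraic_int x" "algebraic_int y"
  shows algebraic_int_add: "algebraic_int (x + y)"
    and algebraic_int_mult: "algebraic_int (x * y)"
proof -
  obtain S where S: "finite S" "1 \<in> S" "\<And>s. s \<in> S \<Longrightarrow> x * s \<in> int_module.span S"
    using algebraic_int_imp_span_stable[OF assms(1)] by metis
  obtain T where T: "finite T" "1 \<in> T" "\<And>t. t \<in> T \<Longrightarrow> y * t \<in> int_module.span T"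
    using algebraic_int_imp_span_stable[OF assms(2)] by metis
  have x: "x * u \<in> int_module.span (S * T)" if "u \<in> S * T" for u
    using int_span_stable_set_times[OF S(1,3) that] .
  have y: "y * u \<in> int_module.span (S * T)" if "u \<in> S * T" for u
    using int_span_stable_set_times[OF T(1,3), of u S] that by (simp add: mult.commute)
  have xspan: "x * w \<in> int_module.span (S * T)" if "w \<in> int_module.span (S * T)" for w
    using that
    by (induction rule: int_module.span_induct_alt)
       (auto simp: distrib_left mult.left_commute[of x]
         intro!: int_module.span_add int_module.span_scale int_module.span_zero x)
  have fin: "finite (S * T)" and one: "1 \<in> S * T"
    using S T set_times_intro[of 1 S 1 T] by (simp_all add: finite_set_times)
  show "algebraic_int (x + y)"
    by (rule algebraic_int_if_span_stable[OF fin one])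
       (auto simp: distrib_right intro: int_module.span_add x y)
  show "algebraic_int (x * y)"
    by (rule algebraic_int_if_span_stable[OF fin one]) (auto simp: mult.assoc intro: xspan y)
qed

end

section \<open>Real quadratic fields\<close>

definition additive_on :: "'a :: plus set \<Rightarrow> ('a \<Rightarrow> 'b :: plus) \<Rightarrow> bool" where
  "additive_on A f \<longleftrightarrow> (\<forall>x\<in>A. \<forall>y\<in>A. f (x + y) = f x + f y)"

lemma additive_onD: "additive_on A f \<Longrightarrow> x \<in> A \<Longrightarrow> y \<in> A \<Longrightarrow> f (x + y) = f x + f y"
  by (simp add: additive_on_def)

locale real_subring =
  fixes R :: "real set"
  assumes one_closed: "1 \<in> R"
    and diff_closed: "x \<in> R \<Longrightarrow> y \<in> R \<Longrightarrow> x - y \<in> R"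
    and mult_closed: "x \<in> R \<Longrightarrow> y \<in> R \<Longrightarrow> x * y \<in> R"
begin

lemma zero_closed: "0 \<in> R"
  using diff_closed[OF one_closed one_closed] by simp

lemma uminus_closed: "x \<in> R \<Longrightarrow> - x \<in> R"
  using diff_closed[OF zero_closed] by simp

lemma add_closed: "x \<in> R \<Longrightarrow> y \<in> R \<Longrightarrow> x + y \<in> R"
  using diff_closed[of x "- y"] uminus_closed by simp

lemma power_closed: "x \<in> R \<Longrightarrow> x ^ k \<in> R"
  by (induction k) (simp_all add: one_closed mult_closed)

lemma of_nat_closed: "of_nat k \<in> R"
  by (induction k) (auto intro: add_closed one_closed zero_closed)

lemma of_int_closed: "of_int k \<in> R"
  by (cases k) (auto intro: of_nat_closed uminus_closed simp del: of_nat_Suc)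

lemma additive_on_of_int_mult:
  fixes f :: "real \<Rightarrow> 'a :: ring_1"
  assumes f: "additive_on R f" and x: "x \<in> R"
  shows "f (of_int k * x) = of_int k * f x"
proof -
  have zero: "f 0 = 0"
    using additive_onD[OF f zero_closed zero_closed] by simp
  have of_nat: "f (of_nat n * x) = of_nat n * f x" for n
    by (induction n)
       (simp_all add: zero distrib_right additive_onD[OF f] mult_closed of_nat_closed x)
  have uminus: "f (- y) = - f y" if "y \<in> R" for y
    using additive_onD[OF f that uminus_closed[OF that]] zero
    by (simp add: eq_neg_iff_add_eq_0 add.commute)
  show ?thesis
  proof (cases k)
    case (nonneg n)
    then show ?thesis by (simp add: of_nat)
  next
    case (neg n)
    then show ?thesis
      using uminus[OF mult_closed[OF of_nat_closed x, of "Suc n"]] of_nat[of "Suc n"]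
      by (simp del: of_nat_Suc)
  qed
qed

end

interpretation rat_real: vector_space "\<lambda>(q::rat) (x::real). of_rat q * x"
  by unfold_locales (auto simp: algebra_simps of_rat_add of_rat_mult)

locale real_quadratic =
  fixes F :: "real set"
  assumes quadratic: "real_quadratic_field F"
begin

abbreviation \<O> :: "real set" where "\<O> \<equiv> ring_of_integers F"

sublocale field: real_subring F
  using quadratic by unfold_locales (auto simp: real_quadratic_field_def)

sublocale integers: real_subring \<O>
proof
  show "x - y \<in> \<O>" if "x \<in> \<O>" "y \<in> \<O>" for x y
    using that algebraic_int_add[of x "- y"] by (auto simp: ring_of_integers_def field.diff_closed)
qed (auto simp: ring_of_integers_def field.one_closed field.mult_closed algebraic_int_mult)

lemma inverse_closed: "x \<in> F \<Longrightarrow> inverse x \<in> F"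
  using quadratic by (simp add: real_quadratic_field_def)

lemma of_rat_closed: "of_rat q \<in> F"
  by (cases q) (auto simp: of_rat_rat divide_inverse
    intro!: field.mult_closed inverse_closed field.of_int_closed)

lemma integer_in_field: "x \<in> \<O> \<Longrightarrow> x \<in> F"
  by (simp add: ring_of_integers_def)

lemma field_eq_rat_combination:
  assumes "\<omega> \<in> F" "\<omega> \<notin> \<rat>" "x \<in> F"
  obtains p q :: rat where "x = of_rat p + of_rat q * \<omega>"
proof -
  have "rat_real.dim F = 2"
    using quadratic by (simp add: real_quadratic_field_def)
  then obtain B where B: "F \<subseteq> rat_real.span B" "card B = 2"
    using rat_real.basis_exists by metis
  have "finite B" using \<open>card B = 2\<close> by (metis card.infinite zero_neq_numeral)
  have "\<omega> \<notin> rat_real.span {1}"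
    using \<open>\<omega> \<notin> \<rat>\<close> by (auto simp: rat_real.span_singleton)
  moreover have "rat_real.independent {1}" by simp
  ultimately have indep: "rat_real.independent {\<omega>, 1}" by (rule rat_real.independent_insertI)
  have "x \<in> rat_real.span {\<omega>, 1}"
  proof (rule ccontr)
    assume x: "x \<notin> rat_real.span {\<omega>, 1}"
    then have "rat_real.independent {x, \<omega>, 1}"
      using indep by (rule rat_real.independent_insertI)
    moreover have "{x, \<omega>, 1} \<subseteq> rat_real.span B"
      using B(1) assms field.one_closed by auto
    ultimately have "card {x, \<omega>, 1} \<le> 2"
      using rat_real.independent_span_bound[OF \<open>finite B\<close>] \<open>card B = 2\<close> by metis
    moreover have "\<omega> \<noteq> 1" "x \<noteq> \<omega>" "x \<noteq> 1"
      using \<open>\<omega> \<notin> \<rat>\<close> x rat_real.span_base[of _ "{\<omega>, 1}"] by auto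
    ultimately show False by simp
  qed
  then obtain q where "x - of_rat q * \<omega> \<in> rat_real.span {1}"
    by (auto simp: rat_real.span_breakdown_eq)
  then obtain p where "x - of_rat q * \<omega> = of_rat p"
    by (auto simp: rat_real.span_singleton)
  then have "x = of_rat p + of_rat q * \<omega>" by simp
  then show ?thesis by (rule that)
qed

lemma int_multiple_eq_int_combination:
  assumes "\<omega> \<in> F" "\<omega> \<notin> \<rat>" "x \<in> F"
  obtains a b c :: int where "c \<noteq> 0" "of_int c * x = of_int a + of_int b * \<omega>"
proof -
  obtain p q where x: "x = of_rat p + of_rat q * \<omega>"
    using field_eq_rat_combination[OF assms] by metis
  obtain a c where p: "p = of_int a / of_int c" "c > 0"
    by (metis quotient_of_div quotient_of_denom_pos surj_pair)
  obtain b d where q: "q = of_int b / of_int d" "d > 0"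
    by (metis quotient_of_div quotient_of_denom_pos surj_pair)
  have cleared: "real_of_rat p * of_int c = of_int a" "real_of_rat q * of_int d = of_int b"
    using p q by (simp_all add: of_rat_divide)
  have "of_int (c * d) * x
      = of_int d * (of_rat p * of_int c) + of_int c * (of_rat q * of_int d) * \<omega>"
    by (simp add: x algebra_simps)
  also have "\<dots> = of_int (a * d) + of_int (b * c) * \<omega>"
    unfolding cleared by simp
  finally have "of_int (c * d) * x = of_int (a * d) + of_int (b * c) * \<omega>" .
  then show ?thesis using that[of "c * d" "a * d" "b * c"] p(2) q(2) by simp
qed

lemma additive_on_integers_eq_0:
  fixes f :: "real \<Rightarrow> complex"
  assumes f: "additive_on \<O> f"
    and \<omega>: "\<omega> \<in> \<O>" "\<omega> \<notin> \<rat>" and "f 1 = 0" "f \<omega> = 0" and x: "x \<in> \<O>"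
  shows "f x = 0"
proof -
  note linear = integers.additive_on_of_int_mult[OF f]
  obtain a b c where "c \<noteq> 0" and c: "of_int c * x = of_int a + of_int b * \<omega>"
    using int_multiple_eq_int_combination[of \<omega> x] \<omega> x integer_in_field by metis
  have "of_int c * f x = f (of_int a * 1 + of_int b * \<omega>)"
    using linear[OF x, of c] c by simp
  also have "\<dots> = of_int a * f 1 + of_int b * f \<omega>"
    using \<omega>(1) linear[OF integers.one_closed, of a] linear[OF \<omega>(1), of b]
    by (subst additive_onD[OF f])
       (auto intro: integers.mult_closed integers.of_int_closed integers.one_closed)
  finally show ?thesis using \<open>c \<noteq> 0\<close> assms(4,5) by simp
qed

lemma integer_units_iff: "x \<in> integer_units F \<longleftrightarrow> x \<in> \<O> \<and> inverse x \<in> \<O> \<and> x \<noteq> 0"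
proof
  assume "x \<in> integer_units F"
  then show "x \<in> \<O> \<and> inverse x \<in> \<O> \<and> x \<noteq> 0"
    using inverse_unique by (auto simp: integer_units_def)
qed (auto simp: integer_units_def intro!: bexI[of _ "inverse x"])

lemma integer_units_one: "1 \<in> integer_units F"
  by (simp add: integer_units_iff integers.one_closed)

lemma integer_units_inverse: "x \<in> integer_units F \<Longrightarrow> inverse x \<in> integer_units F"
  by (simp add: integer_units_iff)

lemma integer_units_mult: "x \<in> integer_units F \<Longrightarrow> y \<in> integer_units F \<Longrightarrow> x * y \<in> integer_units F"
  by (simp add: integer_units_iff integers.mult_closed)

lemma abs_rational_unit:
  assumes "x \<in> integer_units F" "x \<in> \<rat>"
  shows "\<bar>x\<bar> = 1"
proof -
  have "x \<in> \<int>" "inverse x \<in> \<int>"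
    using assms by (auto simp: integer_units_iff ring_of_integers_def
      intro!: rational_algebraic_int_is_int)
  then obtain a b :: int where ab: "x = of_int a" "inverse x = of_int b"
    by (auto elim!: Ints_cases)
  have "real_of_int (a * b) = x * inverse x" using ab by (metis of_int_mult)
  also have "\<dots> = 1" using assms by (simp add: integer_units_iff)
  finally have "a * b = 1" by linarith
  then show ?thesis by (auto simp: ab zmult_eq_1_iff)
qed

end

locale real_quadratic_conjugation = real_quadratic +
  fixes \<sigma> :: "real \<Rightarrow> real"
  assumes conjugation: "galois_conjugation F \<sigma>"
begin

lemma conj_additive: "additive_on F \<sigma>"
  and conj_mult: "x \<in> F \<Longrightarrow> y \<in> F \<Longrightarrow> \<sigma> (x * y) = \<sigma> x * \<sigma> y"
  and conj_field: "x \<in> F \<Longrightarrow> \<sigma> x \<in> F"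
  and conj_inj: "inj_on \<sigma> F"
  using conjugation by (auto simp: additive_on_def galois_conjugation_def bij_betw_def)

lemmas conj_add = additive_onD[OF conj_additive]

lemma conj_zero: "\<sigma> 0 = 0"
  using conj_add[OF field.zero_closed field.zero_closed] by simp

lemma conj_eq_0_iff: "x \<in> F \<Longrightarrow> \<sigma> x = 0 \<longleftrightarrow> x = 0"
  using inj_onD[OF conj_inj, of x 0] conj_zero field.zero_closed by auto

lemma conj_one: "\<sigma> 1 = 1"
  using conj_mult[OF field.one_closed field.one_closed] conj_eq_0_iff[OF field.one_closed] by simp

lemma conj_uminus: "x \<in> F \<Longrightarrow> \<sigma> (- x) = - \<sigma> x"
  using conj_add[of x "- x"] field.uminus_closed[of x] conj_zero by simp

lemma conj_of_int: "\<sigma> (of_int k) = of_int k"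
  using field.additive_on_of_int_mult[OF conj_additive field.one_closed, of k] conj_one by simp

lemma conj_inverse: "x \<in> F \<Longrightarrow> \<sigma> (inverse x) = inverse (\<sigma> x)"
  using conj_mult[of x "inverse x"] inverse_closed[of x] conj_zero conj_one
  by (cases "x = 0") (auto intro!: inverse_unique[symmetric])

lemma conj_of_rat: "\<sigma> (of_rat q) = of_rat q"
  by (cases q) (simp add: of_rat_rat divide_inverse conj_mult conj_inverse conj_of_int
    inverse_closed field.of_int_closed)

lemma conj_poly:
  assumes "x \<in> F"
  shows "poly (map_poly of_int p) x \<in> F \<and>
    \<sigma> (poly (map_poly of_int p) x) = poly (map_poly of_int p) (\<sigma> x)"
  by (induction p) (auto simp: map_poly_pCons conj_zero conj_add conj_mult conj_of_int assms
    field.of_int_closed field.mult_closed field.add_closed field.zero_closed)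

lemma conj_integer:
  assumes "x \<in> \<O>"
  shows "\<sigma> x \<in> \<O>"
proof -
  obtain p :: "int poly" where "poly (map_poly of_int p) x = 0" "lead_coeff p = 1"
    using assms by (auto simp: ring_of_integers_def algebraic_int_altdef_ipoly)
  then have "poly (map_poly of_int p) (\<sigma> x) = 0"
    using conj_poly[OF integer_in_field[OF assms], of p] conj_zero by simp
  with \<open>lead_coeff p = 1\<close> show ?thesis
    using conj_field integer_in_field[OF assms]
    by (auto simp: ring_of_integers_def algebraic_int_altdef_ipoly)
qed

lemma conj_unit: "x \<in> integer_units F \<Longrightarrow> \<sigma> x \<in> integer_units F"
  by (simp add: integer_units_iff conj_integer conj_eq_0_iff integer_in_field flip: conj_inverse)

lemma conj_fixed_imp_rat:
  assumes "x \<in> F" "\<sigma> x = x"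
  shows "x \<in> \<rat>"
proof -
  obtain y where y: "y \<in> F" "\<sigma> y \<noteq> y"
    using conjugation by (auto simp: galois_conjugation_def)
  have "y \<notin> \<rat>" using y conj_of_rat by (auto simp: Rats_def)
  then obtain p q where x: "x = of_rat p + of_rat q * y"
    using field_eq_rat_combination y(1) assms(1) by metis
  then have "\<sigma> x = of_rat p + of_rat q * \<sigma> y"
    by (simp add: conj_add conj_mult of_rat_closed field.mult_closed y conj_of_rat)
  then have "q = 0" using assms(2) y(2) x by simp
  then show ?thesis by (simp add: x)
qed

lemma conj_involution:
  assumes "x \<in> F"
  shows "\<sigma> (\<sigma> x) = x"
proof (cases "x \<in> \<rat>")
  case True
  then show ?thesis using conj_of_rat by (auto simp: Rats_def)
next
  case False
  obtain p q where "x * x = of_rat p + of_rat q * x"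
    using field_eq_rat_combination[OF assms False] field.mult_closed[OF assms assms] by metis
  moreover from this have "\<sigma> x * \<sigma> x = of_rat p + of_rat q * \<sigma> x"
    using conj_mult[OF assms assms]
    by (simp add: conj_add conj_mult of_rat_closed field.mult_closed assms conj_of_rat)
  ultimately have "(\<sigma> x - x) * (\<sigma> x + x - of_rat q) = 0"
    by (simp add: algebra_simps)
  moreover have "\<sigma> x \<noteq> x" using conj_fixed_imp_rat assms False by blast
  ultimately have trace: "\<sigma> x + x = of_rat q" by simp
  have "\<sigma> (\<sigma> x) + \<sigma> x = of_rat q"
    using arg_cong[OF trace, of \<sigma>] by (simp add: conj_add conj_field assms conj_of_rat)
  with trace show ?thesis by simp
qed

lemma abs_norm_unit:
  assumes "x \<in> integer_units F"
  shows "\<bar>x * \<sigma> x\<bar> = 1"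
proof (rule abs_rational_unit)
  have "x \<in> F" using assms by (simp add: integer_units_iff integer_in_field)
  then show "x * \<sigma> x \<in> \<rat>"
    by (intro conj_fixed_imp_rat)
       (simp_all add: field.mult_closed conj_field conj_mult conj_involution)
qed (intro integer_units_mult conj_unit assms)

lemma additive_on_integers_eq_conj_combination:
  fixes f :: "real \<Rightarrow> complex"
  assumes f: "additive_on \<O> f" and \<omega>: "\<omega> \<in> \<O>" "\<omega> \<notin> \<rat>"
  obtains \<alpha> \<beta> where "\<And>x. x \<in> \<O> \<Longrightarrow> f x = \<alpha> * of_real x + \<beta> * of_real (\<sigma> x)"
proof -
  have "\<sigma> \<omega> \<noteq> \<omega>" using conj_fixed_imp_rat \<omega> integer_in_field by blast
  define \<alpha> where "\<alpha> = (f \<omega> - of_real (\<sigma> \<omega>) * f 1) / (of_real \<omega> - of_real (\<sigma> \<omega>))"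
  define \<beta> where "\<beta> = f 1 - \<alpha>"
  define g where "g x = f x - (\<alpha> * of_real x + \<beta> * of_real (\<sigma> x))" for x
  have "\<alpha> * (of_real \<omega> - of_real (\<sigma> \<omega>)) = f \<omega> - of_real (\<sigma> \<omega>) * f 1"
    using \<open>\<sigma> \<omega> \<noteq> \<omega>\<close> by (simp add: \<alpha>_def)
  then have "g \<omega> = 0" "g 1 = 0"
    by (simp_all add: g_def \<beta>_def conj_one algebra_simps)
  moreover have "additive_on \<O> g"
    by (simp add: additive_on_def g_def additive_onD[OF f] conj_add integer_in_field algebra_simps)
  ultimately have "g x = 0" if "x \<in> \<O>" for x
    using additive_on_integers_eq_0 \<omega> that by blast
  then show ?thesis by (intro that[of \<alpha> \<beta>]) (simp add: g_def)
qed

lemma conj_combination_eq_0: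
  fixes \<alpha> \<beta> :: complex
  assumes \<omega>: "\<omega> \<in> \<O>" "\<omega> \<notin> \<rat>" and zero: "\<And>x. x \<in> \<O> \<Longrightarrow> \<alpha> * of_real x + \<beta> * of_real (\<sigma> x) = 0"
  shows "\<alpha> = 0 \<and> \<beta> = 0"
proof -
  have \<beta>: "\<beta> = - \<alpha>"
    using zero[OF integers.one_closed] by (simp add: conj_one eq_neg_iff_add_eq_0 add.commute)
  have "\<alpha> * (of_real \<omega> - of_real (\<sigma> \<omega>)) = 0"
    using zero[OF \<omega>(1)] by (simp add: \<beta> algebra_simps)
  moreover have "\<sigma> \<omega> \<noteq> \<omega>" using conj_fixed_imp_rat \<omega> integer_in_field by blast
  ultimately show ?thesis by (simp add: \<beta>)
qed

end

section \<open>Symmetric powers and tensor products\<close>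

lemma mat22_carrier [simp]: "mat22 a b c d \<in> carrier_mat 2 2"
  and mat22_index [simp]: "mat22 a b c d $$ (0, 0) = a" "mat22 a b c d $$ (0, Suc 0) = b"
    "mat22 a b c d $$ (Suc 0, 0) = c" "mat22 a b c d $$ (Suc 0, Suc 0) = d"
  and mat22_dim [simp]: "dim_row (mat22 a b c d) = 2" "dim_col (mat22 a b c d) = 2"
  by (auto simp: mat22_def mat_of_rows_list_def)

lemma eq_mat22I:
  assumes "A \<in> carrier_mat 2 2" "A $$ (0, 0) = a" "A $$ (0, Suc 0) = b" "A $$ (Suc 0, 0) = c"
    "A $$ (Suc 0, Suc 0) = d"
  shows "A = mat22 a b c d"
  by (rule eq_matI) (use assms in \<open>auto simp: less_2_cases_iff\<close>)

lemma mat22_cases: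
  assumes "A \<in> carrier_mat 2 2"
  obtains a b c d where "A = mat22 a b c d"
  using eq_mat22I[OF assms refl refl refl refl] by blast

lemma mat22_eq_iff [simp]:
  "mat22 a b c d = mat22 a' b' c' d' \<longleftrightarrow> a = a' \<and> b = b' \<and> c = c' \<and> d = d'"
  by (metis mat22_index)

lemma mat22_mult [simp]:
  fixes a b c d :: "'a :: comm_semiring_1"
  shows "mat22 a b c d * mat22 a' b' c' d' =
    mat22 (a * a' + b * c') (a * b' + b * d') (c * a' + d * c') (c * b' + d * d')"
  by (rule eq_mat22I) (auto simp: scalar_prod_def numeral_2_eq_2)

lemma mat22_uminus [simp]:
  fixes a b c d :: "'a :: comm_ring_1"
  shows "- mat22 a b c d = mat22 (- a) (- b) (- c) (- d)"
  by (rule eq_mat22I) auto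

lemma mat22_one: "1\<^sub>m 2 = mat22 1 0 0 1"
  by (rule eq_mat22I) auto

lemma mat22_map [simp]: "map_mat f (mat22 a b c d) = mat22 (f a) (f b) (f c) (f d)"
  by (rule eq_mat22I) auto

lemma mat22_det [simp]:
  fixes a b c d :: "'a :: comm_ring_1"
  shows "det (mat22 a b c d) = a * d - b * c"
proof -
  have "det (mat22 a b c d) = (\<Sum>j<2. mat22 a b c d $$ (0, j) * cofactor (mat22 a b c d) 0 j)"
    by (rule laplace_expansion_row[OF mat22_carrier]) simp
  also have "\<dots> = a * cofactor (mat22 a b c d) 0 0 + b * cofactor (mat22 a b c d) 0 1"
    by (simp add: numeral_2_eq_2)
  also have "cofactor (mat22 a b c d) 0 0 = d"
    unfolding cofactor_def by (subst det_single) (auto simp: mat_delete_def)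
  also have "cofactor (mat22 a b c d) 0 1 = - c"
    unfolding cofactor_def by (subst det_single) (auto simp: mat_delete_def)
  finally show ?thesis by simp
qed

lemma mat22_elements [simp]: "elements_mat (mat22 a b c d) = {a, b, c, d}"
  by (auto simp: elements_mat_def numeral_2_eq_2)

lemma sym_rep_carrier [simp]:
  assumes "g \<in> carrier_mat 2 2"
  shows "sym_rep l g \<in> carrier_mat (l + 1) (l + 1)"
  by (simp add: sym_rep_unique_eq(2)[OF assms])

lemma sym_rep_monomial_vec:
  assumes "g \<in> carrier_mat 2 2"
  shows "sym_rep l g *\<^sub>v monomial_vec l u v =
    monomial_vec l ((g *\<^sub>v vec_of_list [u, v]) $ 0) ((g *\<^sub>v vec_of_list [u, v]) $ 1)"
  using theI'[OF sym_rep_unique_eq(1)[OF assms, of l]] unfolding sym_rep_def by blast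

lemma sym_rep_eqI:
  assumes "g \<in> carrier_mat 2 2" and M: "M \<in> carrier_mat (l + 1) (l + 1)"
    and "\<And>u v. M *\<^sub>v monomial_vec l u v =
      monomial_vec l ((g *\<^sub>v vec_of_list [u, v]) $ 0) ((g *\<^sub>v vec_of_list [u, v]) $ 1)"
  shows "sym_rep l g = M"
  unfolding sym_rep_def using assms by (intro the1_equality[OF sym_rep_unique_eq(1)]) auto

lemma sym_rep_mult:
  assumes g: "g \<in> carrier_mat 2 2" and h: "h \<in> carrier_mat 2 2"
  shows "sym_rep l (g * h) = sym_rep l g * sym_rep l h"
proof (rule sym_rep_eqI)
  fix u v
  let ?uv = "vec_of_list [u, v]" and ?w = "h *\<^sub>v vec_of_list [u, v]"
  have w: "vec_of_list [?w $ 0, ?w $ 1] = ?w"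
    by (rule eq_vecI) (use h in \<open>auto simp: numeral_2_eq_2 less_Suc_eq\<close>)
  have "monomial_vec l u v \<in> carrier_vec (l + 1)" by (simp add: monomial_vec_def)
  then have "(sym_rep l g * sym_rep l h) *\<^sub>v monomial_vec l u v
      = sym_rep l g *\<^sub>v (sym_rep l h *\<^sub>v monomial_vec l u v)"
    by (rule assoc_mult_mat_vec[OF sym_rep_carrier[OF g] sym_rep_carrier[OF h]])
  also have "\<dots> = monomial_vec l ((g *\<^sub>v ?w) $ 0) ((g *\<^sub>v ?w) $ 1)"
    by (simp only: sym_rep_monomial_vec[OF h] sym_rep_monomial_vec[OF g] w)
  also have "g *\<^sub>v ?w = g * h *\<^sub>v ?uv"
    using g h carrier_vecI[of ?uv 2] by simp
  finally show "(sym_rep l g * sym_rep l h) *\<^sub>v monomial_vec l u v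
    = monomial_vec l ((g * h *\<^sub>v ?uv) $ 0) ((g * h *\<^sub>v ?uv) $ 1)" .
next
  show "g * h \<in> carrier_mat 2 2" using g h by simp
  show "sym_rep l g * sym_rep l h \<in> carrier_mat (l + 1) (l + 1)"
    by (rule mult_carrier_mat[OF sym_rep_carrier[OF g] sym_rep_carrier[OF h]])
qed

lemma sym_rep_uminus:
  assumes "g \<in> carrier_mat 2 2"
  shows "sym_rep l (- g) = (- 1) ^ l \<cdot>\<^sub>m sym_rep l g"
proof -
  obtain a b c d where g: "g = mat22 a b c d" using assms by (rule mat22_cases)
  have neg: "[:- x, - y:] ^ k = smult ((- 1) ^ k) ([:x, y:] ^ k)" for x y :: complex and k
    using smult_power[of "- 1" "[:x, y:]" k] by simp
  have "coeff ([:- a, - b:] ^ (l - i) * [:- c, - d:] ^ i) j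
      = (- 1) ^ l * coeff ([:a, b:] ^ (l - i) * [:c, d:] ^ i) j" if "i \<le> l" for i j
  proof -
    have "(- 1) ^ i * (- 1) ^ (l - i) = ((- 1) ^ l :: complex)"
      using that by (simp flip: power_add)
    then show ?thesis by (simp add: neg flip: mult.assoc)
  qed
  then show ?thesis
    unfolding g sym_rep_unique_eq(2)[OF mat22_carrier] mat22_uminus by (intro eq_matI) simp_all
qed

lemma sym_rep_unipotent_index:
  assumes "i \<le> l" "j \<le> l"
  shows "sym_rep l (mat22 1 0 c 1) $$ (i, j) = of_nat (i choose j) * c ^ (i - j)"
proof -
  have "coeff ([:c, 1:] ^ i) j = of_nat (i choose j) * c ^ (i - j)"
  proof (cases "j \<le> i")
    case False
    have "degree ([:c, 1:] ^ i) \<le> i" by (rule order.trans[OF degree_power_le]) simp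
    then show ?thesis using False by (simp add: coeff_eq_0)
  qed (simp add: coeff_linear_poly_power)
  moreover have "[:1, 0:] = (1 :: complex poly)" by simp
  ultimately show ?thesis
    unfolding sym_rep_unique_eq(2)[OF mat22_carrier] using assms by (simp del: pCons_0_0)
qed

lemma sym_rep_diagonal_index:
  assumes "i \<le> l" "j \<le> l"
  shows "sym_rep l (mat22 a 0 0 d) $$ (i, j) = (if i = j then a ^ (l - i) * d ^ i else 0)"
proof -
  have "[:a, 0:] = monom a 0" "[:0, d:] = monom d 1"
    by (simp_all add: monom_0 monom_Suc)
  then have "[:a, 0:] ^ (l - i) * [:0, d:] ^ i = monom (a ^ (l - i) * d ^ i) i"
    by (simp only: monom_power mult_monom mult_0 add_0 nat_mult_1)
  then show ?thesis
    using assms by (simp add: sym_rep_unique_eq(2))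
qed

lemma tensor_space_iff:
  "v \<in> tensor_space m n \<longleftrightarrow> (\<forall>i j. \<not> (i \<le> m \<and> j \<le> n) \<longrightarrow> v (i, j) = 0)"
  by (simp add: tensor_space_def)

lemma tensor_space_eqI:
  assumes "v \<in> tensor_space m n" "w \<in> tensor_space m n"
    and "\<And>i j. i \<le> m \<Longrightarrow> j \<le> n \<Longrightarrow> v (i, j) = w (i, j)"
  shows "v = w"
  using assms by (fastforce simp: tensor_space_iff)

lemma tensor_space_zero: "0 \<in> tensor_space m n"
  and tensor_space_add: "v \<in> tensor_space m n \<Longrightarrow> w \<in> tensor_space m n \<Longrightarrow> v + w \<in> tensor_space m n"
  and tensor_space_diff: "v \<in> tensor_space m n \<Longrightarrow> w \<in> tensor_space m n \<Longrightarrow> v - w \<in> tensor_space m n"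
  and tensor_space_scale: "v \<in> tensor_space m n \<Longrightarrow> (\<lambda>p. z * v p) \<in> tensor_space m n"
  and tensor_space_swap: "v \<in> tensor_space m n \<Longrightarrow> v \<circ> prod.swap \<in> tensor_space n m"
  by (auto simp: tensor_space_iff)

lemma tensor_act_closed:
  "A \<in> carrier_mat (m + 1) p \<Longrightarrow> B \<in> carrier_mat (n + 1) q \<Longrightarrow> tensor_act A B v \<in> tensor_space m n"
  by (auto simp: tensor_space_iff tensor_act_def)

lemma tensor_act_add: "tensor_act A B (v + w) = tensor_act A B v + tensor_act A B w"
  by (rule ext) (auto simp: tensor_act_def algebra_simps sum.distrib)

lemma tensor_act_scale: "tensor_act A B (\<lambda>p. z * v p) = (\<lambda>p. z * tensor_act A B v p)"
  by (rule ext) (auto simp: tensor_act_def sum_distrib_left mult_ac intro!: sum.cong)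

lemma tensor_act_smult:
  "tensor_act (x \<cdot>\<^sub>m A) (y \<cdot>\<^sub>m B) v = (\<lambda>p. x * y * tensor_act A B v p)"
  by (rule ext) (auto simp: tensor_act_def sum_distrib_left mult_ac intro!: sum.cong)

lemma tensor_act_swap: "tensor_act B A (v \<circ> prod.swap) = tensor_act A B v \<circ> prod.swap"
  by (rule ext) (auto simp: tensor_act_def mult_ac intro: sum.swap)

lemma tensor_act_index:
  assumes "A \<in> carrier_mat m p" "B \<in> carrier_mat n q" "i < m" "j < n"
  shows "tensor_act A B v (i, j) =
    (\<Sum>(k, l)\<in>{..<p} \<times> {..<q}. A $$ (i, k) * B $$ (j, l) * v (k, l))"
  using assms by (simp add: tensor_act_def sum.cartesian_product)

lemma tensor_act_mult:
  assumes A: "A \<in> carrier_mat m p" and B: "B \<in> carrier_mat n q"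
    and C: "C \<in> carrier_mat p r" and D: "D \<in> carrier_mat q s"
  shows "tensor_act A B (tensor_act C D v) = tensor_act (A * C) (B * D) v"
proof (rule ext, clarify)
  fix i j
  show "tensor_act A B (tensor_act C D v) (i, j) = tensor_act (A * C) (B * D) v (i, j)"
  proof (cases "i < m \<and> j < n")
    case False
    then show ?thesis using A B by (auto simp: tensor_act_def)
  next
    case True
    have AC: "A * C \<in> carrier_mat m r" and BD: "B * D \<in> carrier_mat n s"
      using assms by auto
    have entry: "(A * C) $$ (i, k') * (B * D) $$ (j, l') =
        (\<Sum>(k, l)\<in>{..<p} \<times> {..<q}. A $$ (i, k) * C $$ (k, k') * (B $$ (j, l) * D $$ (l, l')))"
      if "k' < r" "l' < s" for k' l'
      using that True assms
      by (simp add: scalar_prod_def atLeast0LessThan sum_product sum.cartesian_product)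
    have "tensor_act A B (tensor_act C D v) (i, j) =
        (\<Sum>(k, l)\<in>{..<p} \<times> {..<q}. A $$ (i, k) * B $$ (j, l) * tensor_act C D v (k, l))"
      using True by (simp add: tensor_act_index[OF A B])
    also have "\<dots> = (\<Sum>(k, l)\<in>{..<p} \<times> {..<q}. \<Sum>(k', l')\<in>{..<r} \<times> {..<s}.
        A $$ (i, k) * C $$ (k, k') * (B $$ (j, l) * D $$ (l, l')) * v (k', l'))"
      by (intro sum.cong refl)
         (auto simp: tensor_act_index[OF C D] sum_distrib_left mult_ac intro!: sum.cong)
    also have "\<dots> = (\<Sum>(k', l')\<in>{..<r} \<times> {..<s}. \<Sum>(k, l)\<in>{..<p} \<times> {..<q}.
        A $$ (i, k) * C $$ (k, k') * (B $$ (j, l) * D $$ (l, l')) * v (k', l'))"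
      unfolding case_prod_unfold by (rule sum.swap)
    also have "\<dots> = (\<Sum>(k', l')\<in>{..<r} \<times> {..<s}. (A * C) $$ (i, k') * (B * D) $$ (j, l') * v (k', l'))"
      by (intro sum.cong refl) (auto simp: entry sum_distrib_right intro!: sum.cong)
    also have "\<dots> = tensor_act (A * C) (B * D) v (i, j)"
      using True by (simp add: tensor_act_index[OF AC BD])
    finally show ?thesis .
  qed
qed

section \<open>Unipotent and diagonal elements\<close>

text \<open>Under \<open>e\<^sub>i \<otimes> e\<^sub>j \<leftrightarrow> X\<^sup>i Y\<^sup>j / (i! j!)\<close>, \<open>unip m n a b\<close> is multiplication by \<open>exp(a X + b Y)\<close> on
  \<open>\<complex>[X, Y]/(X\<^bsup>m+1\<^esup>, Y\<^bsup>n+1\<^esup>)\<close>.\<close>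

type_synonym tensor = "nat \<times> nat \<Rightarrow> complex"

definition unip :: "nat \<Rightarrow> nat \<Rightarrow> complex \<Rightarrow> complex \<Rightarrow> tensor \<Rightarrow> tensor" where
  "unip m n a b = tensor_act (sym_rep m (mat22 1 0 a 1)) (sym_rep n (mat22 1 0 b 1))"

definition torus :: "nat \<Rightarrow> nat \<Rightarrow> complex \<Rightarrow> complex \<Rightarrow> tensor \<Rightarrow> tensor" where
  "torus m n a b =
     tensor_act (sym_rep m (mat22 a 0 0 (inverse a))) (sym_rep n (mat22 b 0 0 (inverse b)))"

lemma unip_closed: "unip m n a b v \<in> tensor_space m n"
  and torus_closed: "torus m n a b v \<in> tensor_space m n"
  unfolding unip_def torus_def
  by (rule tensor_act_closed[OF sym_rep_carrier sym_rep_carrier], simp_all)+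

lemma unip_add: "unip m n a b (v + w) = unip m n a b v + unip m n a b w"
  by (simp add: unip_def tensor_act_add)

lemma unip_diff: "unip m n a b (v - w) = unip m n a b v - unip m n a b w"
  using unip_add[of m n a b "v - w" w] by (simp add: algebra_simps)

lemma unip_scale: "unip m n a b (\<lambda>p. z * v p) = (\<lambda>p. z * unip m n a b v p)"
  by (simp add: unip_def tensor_act_scale)

lemma unip_unip: "unip m n a b (unip m n c d v) = unip m n (a + c) (b + d) v"
  unfolding unip_def
  by (subst tensor_act_mult[OF sym_rep_carrier sym_rep_carrier sym_rep_carrier sym_rep_carrier])
     (simp_all add: sym_rep_mult[symmetric])

lemma unip_swap: "unip n m b a (v \<circ> prod.swap) = unip m n a b v \<circ> prod.swap"
  and torus_swap: "torus n m b a (v \<circ> prod.swap) = torus m n a b v \<circ> prod.swap"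
  by (simp_all add: unip_def torus_def tensor_act_swap)

lemma unip_index:
  assumes "i \<le> m" "j \<le> n"
  shows "unip m n a b v (i, j) = (\<Sum>(k, l)\<in>{..i} \<times> {..j}.
    of_nat (i choose k) * a ^ (i - k) * (of_nat (j choose l) * b ^ (j - l)) * v (k, l))"
proof -
  have "unip m n a b v (i, j) = (\<Sum>(k, l)\<in>{..<m + 1} \<times> {..<n + 1}.
      of_nat (i choose k) * a ^ (i - k) * (of_nat (j choose l) * b ^ (j - l)) * v (k, l))"
    unfolding unip_def
    by (subst tensor_act_index[OF sym_rep_carrier sym_rep_carrier])
       (use assms in \<open>auto simp: sym_rep_unipotent_index intro!: sum.cong\<close>)
  also have "\<dots> = (\<Sum>(k, l)\<in>{..i} \<times> {..j}.
      of_nat (i choose k) * a ^ (i - k) * (of_nat (j choose l) * b ^ (j - l)) * v (k, l))"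
    using assms by (intro sum.mono_neutral_right) (auto simp: binomial_eq_0)
  finally show ?thesis .
qed

lemma torus_index:
  assumes "i \<le> m" "j \<le> n"
  shows "torus m n a b v (i, j) =
    a ^ (m - i) * inverse a ^ i * (b ^ (n - j) * inverse b ^ j) * v (i, j)"
proof -
  have "torus m n a b v (i, j) = (\<Sum>(k, l)\<in>{..<m + 1} \<times> {..<n + 1}.
      sym_rep m (mat22 a 0 0 (inverse a)) $$ (i, k) *
      sym_rep n (mat22 b 0 0 (inverse b)) $$ (j, l) * v (k, l))"
    unfolding torus_def using assms
    by (intro tensor_act_index[OF sym_rep_carrier sym_rep_carrier]) simp_all
  also have "\<dots> = (\<Sum>p\<in>{..<m + 1} \<times> {..<n + 1}. if p = (i, j)
      then a ^ (m - i) * inverse a ^ i * (b ^ (n - j) * inverse b ^ j) * v (i, j) else 0)"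
    using assms by (intro sum.cong) (auto simp: sym_rep_diagonal_index split: if_splits)
  also have "\<dots> = a ^ (m - i) * inverse a ^ i * (b ^ (n - j) * inverse b ^ j) * v (i, j)"
    using assms by simp
  finally show ?thesis .
qed

text \<open>Only the linear part of \<open>exp(a X + b Y)\<close> contributes to the coefficient of \<open>X\<^sup>i Y\<^sup>j\<close>.\<close>

lemma unip_leading_terms:
  assumes ij: "i \<le> m" "j \<le> n"
    and low: "\<And>k l. k \<le> i \<Longrightarrow> l \<le> j \<Longrightarrow> k + l + 1 < i + j \<Longrightarrow> w (k, l) = 0"
  shows "unip m n a b w (i, j) =
    w (i, j) + of_nat i * a * w (i - 1, j) + of_nat j * b * w (i, j - 1)"
proof -
  let ?t = "\<lambda>k l. of_nat (i choose k) * a ^ (i - k) * (of_nat (j choose l) * b ^ (j - l)) * w (k, l)"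
  define T where
    "T = {(i, j)} \<union> (if i > 0 then {(i - 1, j)} else {}) \<union> (if j > 0 then {(i, j - 1)} else {})"
  have "unip m n a b w (i, j) = (\<Sum>(k, l)\<in>T. ?t k l)"
    unfolding unip_index[OF ij]
  proof (intro sum.mono_neutral_right)
    show "\<forall>p\<in>{..i} \<times> {..j} - T. (case p of (k, l) \<Rightarrow> ?t k l) = 0"
    proof clarify
      fix k l assume kl: "k \<le> i" "l \<le> j" "(k, l) \<notin> T"
      have "(k = i \<and> l = j) \<or> (i > 0 \<and> k = i - 1 \<and> l = j) \<or> (j > 0 \<and> k = i \<and> l = j - 1)
          \<or> k + l + 1 < i + j"
        using kl(1,2) by presburger
      then have "k + l + 1 < i + j"
        using kl(3) by (auto simp: T_def)
      then show "?t k l = 0" using kl by (simp add: low)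
    qed
  qed (auto simp: T_def)
  also have "\<dots> = w (i, j) + of_nat i * a * w (i - 1, j) + of_nat j * b * w (i, j - 1)"
    by (cases i; cases j) (auto simp: T_def)
  finally show ?thesis .
qed

lemma binomial_integral_sum:
  fixes a b :: "'a :: field_char_0"
  shows "(\<Sum>k\<le>i. of_nat (i choose k) * a ^ (i - k) * (b ^ (k + 1) / of_nat (k + 1)))
    = (a + b) ^ (i + 1) / of_nat (i + 1) - a ^ (i + 1) / of_nat (i + 1)"
proof -
  have summand: "of_nat (Suc i choose Suc k) * b ^ Suc k * a ^ (i - k)
      = of_nat (i + 1) * (of_nat (i choose k) * a ^ (i - k) * (b ^ (k + 1) / of_nat (k + 1)))" for k
  proof -
    have "of_nat (Suc i) * of_nat (i choose k) = (of_nat (Suc i choose Suc k) * of_nat (Suc k) :: 'a)"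
      by (simp only: Suc_times_binomial_eq flip: of_nat_mult)
    then have
      "of_nat (Suc i choose Suc k) = (of_nat (Suc i) * of_nat (i choose k) / of_nat (Suc k) :: 'a)"
      by (simp del: of_nat_Suc add: eq_divide_eq)
    then show ?thesis by (simp del: of_nat_Suc power_Suc)
  qed
  have "(a + b) ^ (i + 1) = (b + a) ^ Suc i" by (simp add: add.commute)
  also have "\<dots> = (\<Sum>k\<le>Suc i. of_nat (Suc i choose k) * b ^ k * a ^ (Suc i - k))"
    by (rule binomial_ring)
  also have "\<dots> = a ^ (i + 1) + (\<Sum>k\<le>i. of_nat (Suc i choose Suc k) * b ^ Suc k * a ^ (i - k))"
    by (subst sum.atMost_Suc_shift) simp
  also have "\<dots> = a ^ (i + 1) + of_nat (i + 1) *
      (\<Sum>k\<le>i. of_nat (i choose k) * a ^ (i - k) * (b ^ (k + 1) / of_nat (k + 1)))"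
    unfolding sum_distrib_left by (simp only: summand)
  finally show ?thesis
    by (simp del: of_nat_Suc of_nat_add add: eq_divide_eq flip: diff_divide_distrib)
qed

text \<open>The polynomial \<open>Y\<^sup>n/n! (exp(a X) - 1)/X\<close>, that is, \<open>Y\<^sup>n/n!\<close> times the integral of \<open>exp(x X)\<close>
  over \<open>x \<in> [0, a]\<close>.\<close>

definition edge_integral :: "nat \<Rightarrow> nat \<Rightarrow> complex \<Rightarrow> tensor" where
  "edge_integral m n a = (\<lambda>(i, j). if i \<le> m \<and> j = n then a ^ (i + 1) / of_nat (i + 1) else 0)"

lemma edge_integral_closed: "edge_integral m n a \<in> tensor_space m n"
  by (auto simp: edge_integral_def tensor_space_iff)

lemma unip_edge_integral:
  "unip m n a b (edge_integral m n c) = edge_integral m n (a + c) - edge_integral m n a"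
proof (rule tensor_space_eqI)
  fix i j assume ij: "i \<le> m" "j \<le> n"
  have "unip m n a b (edge_integral m n c) (i, j) = (\<Sum>k\<le>i. \<Sum>l\<le>j. if l = j then (if j = n
      then of_nat (i choose k) * a ^ (i - k) * (c ^ (k + 1) / of_nat (k + 1)) else 0) else 0)"
    unfolding unip_index[OF ij] sum.cartesian_product
    using ij by (intro sum.cong) (auto simp: edge_integral_def)
  also have "\<dots> = (if j = n
      then (\<Sum>k\<le>i. of_nat (i choose k) * a ^ (i - k) * (c ^ (k + 1) / of_nat (k + 1))) else 0)"
    by simp
  also have "\<dots> = (edge_integral m n (a + c) - edge_integral m n a) (i, j)"
    unfolding binomial_integral_sum using ij by (simp add: edge_integral_def)
  finally show "unip m n a b (edge_integral m n c) (i, j)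
    = (edge_integral m n (a + c) - edge_integral m n a) (i, j)" .
qed (intro unip_closed tensor_space_diff edge_integral_closed)+

lemma torus_edge_integral:
  assumes "a \<noteq> 0"
  shows "torus m n a b (edge_integral m n (a\<^sup>2 * c))
    = (\<lambda>p. a ^ (m + 2) * inverse b ^ n * edge_integral m n c p)"
proof (rule tensor_space_eqI)
  fix i j assume ij: "i \<le> m" "j \<le> n"
  have "a ^ (m - i) * inverse a ^ i * (a\<^sup>2) ^ (i + 1) = a ^ (m + 2)"
  proof -
    have "a ^ (m + 2) = a ^ (m - i) * a ^ i * a\<^sup>2" using ij by (simp flip: power_add)
    moreover have "(a\<^sup>2) ^ (i + 1) = a ^ i * a ^ i * a\<^sup>2"
      by (simp add: power2_eq_square power_mult_distrib mult_ac)
    ultimately show ?thesis using assms by (simp add: power_inverse)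
  qed
  then show "torus m n a b (edge_integral m n (a\<^sup>2 * c)) (i, j)
      = a ^ (m + 2) * inverse b ^ n * edge_integral m n c (i, j)"
    using ij by (auto simp: torus_index edge_integral_def power_mult_distrib mult_ac)
qed (intro torus_closed tensor_space_scale edge_integral_closed)+

section \<open>Cocycles of unipotent actions\<close>

text \<open>For homogeneous \<open>g\<close> and \<open>h\<close> of degree \<open>d\<close> with \<open>X h = Y g\<close>, the common antiderivative \<open>v\<close>
  satisfies \<open>g = X v\<close> and \<open>h = Y v\<close>, up to multiples of \<open>Y\<^sup>n\<close> in \<open>g\<close> and of \<open>X\<^sup>m\<close> in \<open>h\<close>.\<close>

definition common_antiderivative ::
  "nat \<Rightarrow> nat \<Rightarrow> nat \<Rightarrow> tensor \<Rightarrow> tensor \<Rightarrow> tensor" where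
  "common_antiderivative m n d g h = (\<lambda>(i, j). if i \<le> m \<and> j \<le> n \<and> i + j + 1 = d then
     if i < m then g (i + 1, j) / of_nat (i + 1)
     else if j < n then h (m, j + 1) / of_nat (j + 1) else 0 else 0)"

lemma common_antiderivative_closed: "common_antiderivative m n d g h \<in> tensor_space m n"
  by (auto simp: common_antiderivative_def tensor_space_iff)

lemma common_antiderivative_eq_0: "i + j + 1 \<noteq> d \<Longrightarrow> common_antiderivative m n d g h (i, j) = 0"
  by (simp add: common_antiderivative_def)

lemma common_antiderivative_X:
  assumes comm: "\<And>i j. i \<le> m \<Longrightarrow> j \<le> n \<Longrightarrow> i + j = d + 1 \<Longrightarrow>
      of_nat i * h (i - 1, j) = of_nat j * g (i, j - 1)"
    and ij: "i \<le> m" "j \<le> n" "i + j = d"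
  shows "g (i, j) = of_nat i * common_antiderivative m n d g h (i - 1, j) +
    (if i = 0 \<and> j = n then g (0, n) else 0)"
proof (cases i)
  case 0
  then show ?thesis using comm[of 0 "j + 1"] ij by (cases "j = n") (auto simp del: of_nat_Suc)
next
  case (Suc k)
  then show ?thesis using ij by (auto simp: common_antiderivative_def simp del: of_nat_Suc)
qed

lemma common_antiderivative_Y:
  assumes comm: "\<And>i j. i \<le> m \<Longrightarrow> j \<le> n \<Longrightarrow> i + j = d + 1 \<Longrightarrow>
      of_nat i * h (i - 1, j) = of_nat j * g (i, j - 1)"
    and ij: "i \<le> m" "j \<le> n" "i + j = d"
  shows "h (i, j) = of_nat j * common_antiderivative m n d g h (i, j - 1) +
    (if i = m \<and> j = 0 then h (m, 0) else 0)"
proof -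
  consider (bottom) "j = 0" | (edge) "j \<noteq> 0" "i = m" | (inner) "j \<noteq> 0" "i < m"
    using ij(1) by linarith
  then show ?thesis
  proof cases
    case bottom
    then show ?thesis using comm[of "i + 1" 0] ij by (cases "i = m") (auto simp del: of_nat_Suc)
  next
    case edge
    then show ?thesis using ij by (simp add: common_antiderivative_def)
  next
    case inner
    then have "h (i, j) = of_nat j * (g (i + 1, j - 1) / of_nat (i + 1))"
      using comm[of "i + 1" j] ij by (simp add: eq_divide_eq mult.commute del: of_nat_Suc)
    then show ?thesis using inner ij by (simp add: common_antiderivative_def)
  qed
qed

locale unipotent_module =
  fixes A :: "'a :: ab_semigroup_add set" and s t :: "'a \<Rightarrow> complex" and m n :: nat
  assumes A_add: "x \<in> A \<Longrightarrow> y \<in> A \<Longrightarrow> x + y \<in> A"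
    and s_additive: "additive_on A s" and t_additive: "additive_on A t"
    and additive_combination: "additive_on A f \<Longrightarrow> \<exists>\<alpha> \<beta>. \<forall>x\<in>A. f x = \<alpha> * s x + \<beta> * t x"
    and combination_eq_0: "(\<And>x. x \<in> A \<Longrightarrow> \<alpha> * s x + \<beta> * t x = 0) \<Longrightarrow> \<alpha> = 0 \<and> \<beta> = 0"
begin

definition act :: "'a \<Rightarrow> tensor \<Rightarrow> tensor" where
  "act x = unip m n (s x) (t x)"

definition cocycle :: "('a \<Rightarrow> tensor) \<Rightarrow> bool" where
  "cocycle f \<longleftrightarrow> (\<forall>x\<in>A. f x \<in> tensor_space m n) \<and>
     (\<forall>x\<in>A. \<forall>y\<in>A. f (x + y) = f x + act x (f y))"

definition vanishes_below :: "nat \<Rightarrow> ('a \<Rightarrow> tensor) \<Rightarrow> bool" where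
  "vanishes_below d f \<longleftrightarrow> (\<forall>x\<in>A. \<forall>i j. i + j < d \<longrightarrow> f x (i, j) = 0)"

definition has_degree_part :: "nat \<Rightarrow> ('a \<Rightarrow> tensor) \<Rightarrow> tensor \<Rightarrow> tensor \<Rightarrow> bool" where
  "has_degree_part d f g h \<longleftrightarrow> (\<forall>x\<in>A. \<forall>i j. i \<le> m \<and> j \<le> n \<and> i + j = d \<longrightarrow>
     f x (i, j) = s x * g (i, j) + t x * h (i, j))"

definition cocycle_X :: "'a \<Rightarrow> tensor" where
  "cocycle_X x = edge_integral m n (s x)"

definition cocycle_Y :: "'a \<Rightarrow> tensor" where
  "cocycle_Y x = edge_integral n m (t x) \<circ> prod.swap"

definition std_cocycle :: "tensor \<Rightarrow> complex \<Rightarrow> complex \<Rightarrow> 'a \<Rightarrow> tensor" where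
  "std_cocycle v \<alpha> \<beta> x = (act x v - v) + (\<lambda>p. \<alpha> * cocycle_X x p) + (\<lambda>p. \<beta> * cocycle_Y x p)"

text \<open>Exchanging the two tensor factors exchanges the roles of \<open>X\<close> and \<open>Y\<close>.\<close>

lemma swapped: "unipotent_module A t s"
proof
  show "\<exists>\<alpha> \<beta>. \<forall>x\<in>A. f x = \<alpha> * t x + \<beta> * s x"
    if "additive_on A f" for f
    using additive_combination[OF that] by (metis add.commute)
  show "\<alpha> = 0 \<and> \<beta> = 0" if "\<And>x. x \<in> A \<Longrightarrow> \<alpha> * t x + \<beta> * s x = 0" for \<alpha> \<beta>
    using combination_eq_0[of \<beta> \<alpha>] that by (simp add: add.commute)
qed (fact A_add s_additive t_additive)+

lemmas s_add = additive_onD[OF s_additive] and t_add = additive_onD[OF t_additive]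

lemma act_closed: "act x v \<in> tensor_space m n"
  by (simp add: act_def unip_closed)

lemma act_add: "act x (v + w) = act x v + act x w"
  and act_diff: "act x (v - w) = act x v - act x w"
  and act_scale: "act x (\<lambda>p. z * v p) = (\<lambda>p. z * act x v p)"
  by (simp_all add: act_def unip_add unip_diff unip_scale)

lemma act_act: "x \<in> A \<Longrightarrow> y \<in> A \<Longrightarrow> act x (act y v) = act (x + y) v"
  by (simp add: act_def unip_unip s_add t_add)

lemma cocycle_closed: "cocycle f \<Longrightarrow> x \<in> A \<Longrightarrow> f x \<in> tensor_space m n"
  and cocycle_eq: "cocycle f \<Longrightarrow> x \<in> A \<Longrightarrow> y \<in> A \<Longrightarrow> f (x + y) = f x + act x (f y)"
  by (simp_all add: cocycle_def)

lemma cocycle_add: "cocycle f \<Longrightarrow> cocycle h \<Longrightarrow> cocycle (\<lambda>x. f x + h x)"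
  by (simp add: cocycle_def act_add tensor_space_add algebra_simps)

lemma cocycle_diff: "cocycle f \<Longrightarrow> cocycle h \<Longrightarrow> cocycle (\<lambda>x. f x - h x)"
  by (simp add: cocycle_def act_diff tensor_space_diff algebra_simps)

lemma cocycle_scale: "cocycle f \<Longrightarrow> cocycle (\<lambda>x p. z * f x p)"
  by (simp add: cocycle_def act_scale tensor_space_scale fun_eq_iff distrib_left)

lemma cocycle_coboundary: "v \<in> tensor_space m n \<Longrightarrow> cocycle (\<lambda>x. act x v - v)"
  by (simp add: cocycle_def act_diff act_act tensor_space_diff act_closed)

lemma cocycle_cocycle_X: "cocycle cocycle_X"
  by (simp add: cocycle_def cocycle_X_def edge_integral_closed act_def unip_edge_integral s_add)

lemma cocycle_cocycle_Y: "cocycle cocycle_Y"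
proof -
  have "edge_integral n m a \<circ> prod.swap \<in> tensor_space m n" for a
    by (intro tensor_space_swap edge_integral_closed)
  then show ?thesis
    by (auto simp: cocycle_def cocycle_Y_def act_def unip_swap unip_edge_integral t_add)
qed

lemma cocycle_std_cocycle: "v \<in> tensor_space m n \<Longrightarrow> cocycle (std_cocycle v \<alpha> \<beta>)"
  unfolding std_cocycle_def
  by (intro cocycle_add cocycle_scale cocycle_coboundary cocycle_cocycle_X cocycle_cocycle_Y)

lemma std_cocycle_add:
  "std_cocycle v \<alpha> \<beta> x + std_cocycle w \<gamma> \<delta> x = std_cocycle (v + w) (\<alpha> + \<gamma>) (\<beta> + \<delta>) x"
  by (simp add: std_cocycle_def act_add fun_eq_iff algebra_simps)

lemma std_cocycle_swap:
  "unipotent_module.std_cocycle t s n m (v \<circ> prod.swap) \<beta> \<alpha> x = std_cocycle v \<alpha> \<beta> x \<circ> prod.swap"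
proof -
  interpret swap: unipotent_module A t s n m by (rule swapped)
  show ?thesis
    by (simp add: std_cocycle_def swap.std_cocycle_def act_def swap.act_def unip_swap
      cocycle_X_def swap.cocycle_X_def cocycle_Y_def swap.cocycle_Y_def fun_eq_iff)
qed

lemma std_cocycle_leading_terms:
  assumes v: "\<forall>k l. k + l + 1 \<noteq> d \<longrightarrow> v (k, l) = 0"
    and "d \<noteq> n \<longrightarrow> \<alpha> = 0" "d \<noteq> m \<longrightarrow> \<beta> = 0"
    and ij: "i \<le> m" "j \<le> n" "i + j \<le> d"
  shows "std_cocycle v \<alpha> \<beta> x (i, j) =
      s x * (of_nat i * v (i - 1, j) + (if i = 0 \<and> j = n then \<alpha> else 0)) +
      t x * (of_nat j * v (i, j - 1) + (if i = m \<and> j = 0 then \<beta> else 0))"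
proof -
  have "act x v (i, j) = v (i, j) + of_nat i * s x * v (i - 1, j) + of_nat j * t x * v (i, j - 1)"
    unfolding act_def using ij v by (intro unip_leading_terms) auto
  moreover have "\<alpha> * cocycle_X x (i, j) = s x * (if i = 0 \<and> j = n then \<alpha> else 0)"
    using assms by (auto simp: cocycle_X_def edge_integral_def)
  moreover have "\<beta> * cocycle_Y x (i, j) = t x * (if i = m \<and> j = 0 then \<beta> else 0)"
    using assms by (auto simp: cocycle_Y_def edge_integral_def)
  ultimately show ?thesis by (simp add: std_cocycle_def algebra_simps)
qed

lemma cocycle_lowest_part:
  assumes f: "cocycle f" and low: "vanishes_below d f"
  obtains g h where "has_degree_part d f g h"
proof -
  have "\<exists>\<alpha> \<beta>. \<forall>x\<in>A. f x (i, j) = \<alpha> * s x + \<beta> * t x" if ij: "i \<le> m" "j \<le> n" "i + j = d" for i j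
  proof (intro additive_combination, unfold additive_on_def, intro ballI)
    fix x y assume xy: "x \<in> A" "y \<in> A"
    have f_low: "f y (k, l) = 0" if "k + l < d" for k l
      using low xy(2) that by (simp add: vanishes_below_def)
    have "of_nat i * f y (i - 1, j) = 0"
      using ij f_low by (cases i) auto
    moreover have "of_nat j * f y (i, j - 1) = 0"
      using ij f_low by (cases j) auto
    ultimately have "act x (f y) (i, j) = f y (i, j)"
      unfolding act_def using ij f_low by (subst unip_leading_terms) (auto simp: mult_ac)
    then show "f (x + y) (i, j) = f x (i, j) + f y (i, j)"
      by (simp add: cocycle_eq[OF f xy])
  qed
  then obtain g h where "\<And>i j x. i \<le> m \<Longrightarrow> j \<le> n \<Longrightarrow> i + j = d \<Longrightarrow> x \<in> A \<Longrightarrow>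
      f x (i, j) = g i j * s x + h i j * t x"
    by metis
  then show ?thesis
    by (intro that[of "\<lambda>(i, j). g i j" "\<lambda>(i, j). h i j"])
       (simp add: has_degree_part_def mult.commute)
qed

lemma cross_difference_nonzero: "\<exists>x\<in>A. \<exists>y\<in>A. s x * t y \<noteq> s y * t x"
proof (rule ccontr)
  assume "\<not> ?thesis"
  then have "t y * s x + (- s y) * t x = 0" if "x \<in> A" "y \<in> A" for x y
    using that by (simp add: mult.commute)
  then have "t y = 0" "s y = 0" if "y \<in> A" for y
    using combination_eq_0[of "t y" "- s y"] that by auto
  then show False using combination_eq_0[of 1 0] by simp
qed

lemma cocycle_lowest_part_commutes:
  assumes f: "cocycle f" and low: "vanishes_below d f" and gh: "has_degree_part d f g h"
    and ij: "i \<le> m" "j \<le> n" "i + j = d + 1"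
  shows "of_nat i * h (i - 1, j) = of_nat j * g (i, j - 1)"
proof -
  obtain x y where xy: "x \<in> A" "y \<in> A" and indep: "s x * t y \<noteq> s y * t x"
    using cross_difference_nonzero by blast
  have expand: "f (x + y) (i, j) = f x (i, j) + f y (i, j) +
      s x * (of_nat i * f y (i - 1, j)) + t x * (of_nat j * f y (i, j - 1))"
    if "x \<in> A" "y \<in> A" for x y
    unfolding cocycle_eq[OF f that] act_def using ij low that(2)
    by (simp add: vanishes_below_def unip_leading_terms[OF ij(1,2)] mult_ac)
  have X: "of_nat i * f x (i - 1, j) = of_nat i * (s x * g (i - 1, j) + t x * h (i - 1, j))"
    if "x \<in> A" for x
    using gh ij that by (cases i) (auto simp: has_degree_part_def)
  have Y: "of_nat j * f x (i, j - 1) = of_nat j * (s x * g (i, j - 1) + t x * h (i, j - 1))"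
    if "x \<in> A" for x
    using gh ij that by (cases j) (auto simp: has_degree_part_def)
  have "f (x + y) (i, j) = f (y + x) (i, j)" by (simp add: add.commute)
  then have "(s x * t y - s y * t x) * (of_nat i * h (i - 1, j) - of_nat j * g (i, j - 1)) = 0"
    unfolding expand[OF xy] expand[OF xy(2,1)] X[OF xy(1)] X[OF xy(2)] Y[OF xy(1)] Y[OF xy(2)]
    by (simp add: algebra_simps)
  with indep show ?thesis by simp
qed

lemma cocycle_eq_std_cocycle_lowest:
  assumes f: "cocycle f" and low: "vanishes_below d f"
  obtains v \<alpha> \<beta> where "v \<in> tensor_space m n"
    and "\<And>x i j. x \<in> A \<Longrightarrow> i \<le> m \<Longrightarrow> j \<le> n \<Longrightarrow> i + j \<le> d \<Longrightarrow> f x (i, j) = std_cocycle v \<alpha> \<beta> x (i, j)"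
proof -
  obtain g h where gh: "has_degree_part d f g h"
    using cocycle_lowest_part[OF f low] .
  define v where "v = common_antiderivative m n d g h"
  define \<alpha> where "\<alpha> = (if d = n then g (0, n) else 0)"
  define \<beta> where "\<beta> = (if d = m then h (m, 0) else 0)"
  note comm = cocycle_lowest_part_commutes[OF f low gh]
  show ?thesis
  proof (rule that)
    show "v \<in> tensor_space m n" by (simp add: v_def common_antiderivative_closed)
    fix x i j assume x: "x \<in> A" and ij: "i \<le> m" "j \<le> n" "i + j \<le> d"
    have leading: "std_cocycle v \<alpha> \<beta> x (i, j) =
        s x * (of_nat i * v (i - 1, j) + (if i = 0 \<and> j = n then \<alpha> else 0)) +
        t x * (of_nat j * v (i, j - 1) + (if i = m \<and> j = 0 then \<beta> else 0))"
      by (rule std_cocycle_leading_terms[OF _ _ _ ij])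
         (simp_all add: v_def \<alpha>_def \<beta>_def common_antiderivative_eq_0)
    show "f x (i, j) = std_cocycle v \<alpha> \<beta> x (i, j)"
    proof (cases "i + j = d")
      case True
      have "g (i, j) = of_nat i * v (i - 1, j) + (if i = 0 \<and> j = n then \<alpha> else 0)"
        using common_antiderivative_X[OF comm ij(1,2) True] True by (auto simp: v_def \<alpha>_def)
      moreover have "h (i, j) = of_nat j * v (i, j - 1) + (if i = m \<and> j = 0 then \<beta> else 0)"
        using common_antiderivative_Y[OF comm ij(1,2) True] True by (auto simp: v_def \<beta>_def)
      moreover have "f x (i, j) = s x * g (i, j) + t x * h (i, j)"
        using gh x ij True by (simp add: has_degree_part_def)
      ultimately show ?thesis unfolding leading by (simp only:)
    next
      case False
      then have "of_nat i * v (i - 1, j) = 0" "of_nat j * v (i, j - 1) = 0"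
        using ij by (cases i; cases j; simp add: v_def common_antiderivative_eq_0)+
      moreover have "(if i = 0 \<and> j = n then \<alpha> else 0) = 0" "(if i = m \<and> j = 0 then \<beta> else 0) = 0"
        using False by (auto simp: \<alpha>_def \<beta>_def)
      ultimately have "std_cocycle v \<alpha> \<beta> x (i, j) = 0"
        unfolding leading by (simp only: add_0 mult_zero_right)
      then show ?thesis using low x False ij by (simp add: vanishes_below_def)
    qed
  qed
qed

lemma cocycle_eq_std_cocycle_below:
  assumes f: "cocycle f"
  shows "\<exists>v\<in>tensor_space m n. \<exists>\<alpha> \<beta>. \<forall>x\<in>A. \<forall>i j. i + j < d \<longrightarrow> f x (i, j) = std_cocycle v \<alpha> \<beta> x (i, j)"
proof (induction d)
  case 0
  show ?case using tensor_space_zero by auto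
next
  case (Suc d)
  then obtain v \<alpha> \<beta> where v: "v \<in> tensor_space m n"
    and below: "\<And>x i j. x \<in> A \<Longrightarrow> i + j < d \<Longrightarrow> f x (i, j) = std_cocycle v \<alpha> \<beta> x (i, j)"
    by blast
  define r where "r x = f x - std_cocycle v \<alpha> \<beta> x" for x
  have "cocycle r"
    unfolding r_def by (intro cocycle_diff cocycle_std_cocycle f v)
  moreover have "vanishes_below d r"
    using below by (simp add: vanishes_below_def r_def)
  ultimately obtain w \<gamma> \<delta> where w: "w \<in> tensor_space m n"
    and lowest: "\<And>x i j. x \<in> A \<Longrightarrow> i \<le> m \<Longrightarrow> j \<le> n \<Longrightarrow> i + j \<le> d \<Longrightarrow>
      r x (i, j) = std_cocycle w \<gamma> \<delta> x (i, j)"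
    using cocycle_eq_std_cocycle_lowest by blast
  have vw: "v + w \<in> tensor_space m n" by (rule tensor_space_add[OF v w])
  have "f x (i, j) = std_cocycle (v + w) (\<alpha> + \<gamma>) (\<beta> + \<delta>) x (i, j)"
    if "x \<in> A" "i + j < Suc d" for x i j
  proof (cases "i \<le> m \<and> j \<le> n")
    case True
    then have "f x (i, j) - std_cocycle v \<alpha> \<beta> x (i, j) = std_cocycle w \<gamma> \<delta> x (i, j)"
      using lowest[of x i j] that by (simp add: r_def)
    then show ?thesis by (simp flip: std_cocycle_add add: algebra_simps)
  next
    case False
    then show ?thesis
      using cocycle_closed[OF f that(1)] cocycle_closed[OF cocycle_std_cocycle[OF vw] that(1)]
      by (simp add: tensor_space_iff)
  qed
  with vw show ?case by blast
qed

theorem cocycle_eq_std_cocycle: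
  assumes f: "cocycle f"
  obtains v \<alpha> \<beta> where "v \<in> tensor_space m n" "\<And>x. x \<in> A \<Longrightarrow> f x = std_cocycle v \<alpha> \<beta> x"
proof -
  obtain v \<alpha> \<beta> where v: "v \<in> tensor_space m n"
    and below: "\<And>x i j. x \<in> A \<Longrightarrow> i + j < m + n + 1 \<Longrightarrow> f x (i, j) = std_cocycle v \<alpha> \<beta> x (i, j)"
    using cocycle_eq_std_cocycle_below[OF f, of "m + n + 1"] by blast
  have "f x = std_cocycle v \<alpha> \<beta> x" if "x \<in> A" for x
    using cocycle_closed[OF f that] cocycle_closed[OF cocycle_std_cocycle[OF v] that]
    by (rule tensor_space_eqI) (simp add: below that)
  with v show ?thesis by (rule that)
qed

text \<open>The coefficients of \<open>Y, \<dots>, Y\<^sup>n\<close> in \<open>act x v - v\<close> show successively that those of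
  \<open>1, \<dots>, Y\<^bsup>n-2\<^esup>\<close> in \<open>v\<close> vanish.\<close>

lemma std_cocycle_eq_0_imp_coeff_X_eq_0:
  assumes zero: "\<And>x. x \<in> A \<Longrightarrow> std_cocycle v \<alpha> \<beta> x = 0" and \<beta>: "m = 0 \<Longrightarrow> \<beta> = 0"
  shows "\<alpha> = 0"
proof -
  have column: "act x v (0, j) - v (0, j) + (if j = n then \<alpha> * s x else 0) = 0"
    if "x \<in> A" "j \<le> n" for x j
  proof -
    have "\<beta> * cocycle_Y x (0, j) = 0" using \<beta> by (auto simp: cocycle_Y_def edge_integral_def)
    then show ?thesis
      using fun_cong[OF zero[OF that(1)], of "(0, j)"] that(2)
      by (auto simp: std_cocycle_def cocycle_X_def edge_integral_def)
  qed
  obtain y where y: "y \<in> A" "t y \<noteq> 0" using combination_eq_0[of 0 1] by auto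
  have v: "v (0, l) = 0" if "l + 1 < n" for l
    using that
  proof (induction l rule: less_induct)
    case (less l)
    have "act y v (0, l + 1) = v (0, l + 1) + of_nat (l + 1) * t y * v (0, l)"
      unfolding act_def using less by (subst unip_leading_terms) auto
    then show ?case
      using column[OF y(1), of "l + 1"] less.prems y(2) by (simp del: of_nat_Suc)
  qed
  have "\<alpha> * s x + (of_nat n * v (0, n - 1)) * t x = 0" if "x \<in> A" for x
  proof -
    have "act x v (0, n) = v (0, n) + of_nat n * t x * v (0, n - 1)"
      unfolding act_def using v by (subst unip_leading_terms) auto
    then show ?thesis using column[OF that, of n] by (simp add: algebra_simps)
  qed
  then show ?thesis using combination_eq_0 by blast
qed

theorem std_cocycle_eq_0_imp_coeffs_eq_0:
  assumes zero: "\<And>x. x \<in> A \<Longrightarrow> std_cocycle v \<alpha> \<beta> x = 0"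
  shows "\<alpha> = 0 \<and> \<beta> = 0"
proof -
  interpret swap: unipotent_module A t s n m by (rule swapped)
  have "swap.std_cocycle (v \<circ> prod.swap) \<beta> \<alpha> x = 0" if "x \<in> A" for x
    unfolding std_cocycle_swap zero[OF that] by (simp add: fun_eq_iff)
  then have X: "(m = 0 \<Longrightarrow> \<beta> = 0) \<Longrightarrow> \<alpha> = 0" and Y: "(n = 0 \<Longrightarrow> \<alpha> = 0) \<Longrightarrow> \<beta> = 0"
    using zero std_cocycle_eq_0_imp_coeff_X_eq_0[of v \<alpha> \<beta>]
      swap.std_cocycle_eq_0_imp_coeff_X_eq_0[of "v \<circ> prod.swap" \<beta> \<alpha>] by blast+
  show ?thesis
  proof (cases "m = 0 \<and> n = 0")
    case True
    have "std_cocycle v \<alpha> \<beta> x (0, 0)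
        = \<alpha> * edge_integral m n (s x) (0, 0) + \<beta> * edge_integral n m (t x) (0, 0)" for x
      by (simp add: std_cocycle_def act_def unip_leading_terms cocycle_X_def cocycle_Y_def)
    then have "\<alpha> * s x + \<beta> * t x = 0" if "x \<in> A" for x
      using fun_cong[OF zero[OF that], of "(0, 0)"] True by (simp add: edge_integral_def)
    then show ?thesis by (rule combination_eq_0)
  qed (use X Y in blast)
qed

end

section \<open>First cohomology of a subgroup\<close>

locale H1_module = group G for G (structure) +
  fixes N :: "'a set" and V :: "('i \<Rightarrow> complex) set" and a :: "'a \<Rightarrow> ('i \<Rightarrow> complex) \<Rightarrow> 'i \<Rightarrow> complex"
  assumes N: "subgroup N G"
    and V_zero: "0 \<in> V"
    and V_add: "v \<in> V \<Longrightarrow> w \<in> V \<Longrightarrow> v + w \<in> V"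
    and V_scale: "v \<in> V \<Longrightarrow> (\<lambda>i. z * v i) \<in> V"
    and a_closed: "x \<in> carrier G \<Longrightarrow> v \<in> V \<Longrightarrow> a x v \<in> V"
    and a_add: "x \<in> carrier G \<Longrightarrow> v \<in> V \<Longrightarrow> w \<in> V \<Longrightarrow> a x (v + w) = a x v + a x w"
    and a_scale: "x \<in> carrier G \<Longrightarrow> v \<in> V \<Longrightarrow> a x (\<lambda>i. z * v i) = (\<lambda>i. z * a x v i)"
    and a_mult: "x \<in> carrier G \<Longrightarrow> y \<in> carrier G \<Longrightarrow> v \<in> V \<Longrightarrow> a (x \<otimes> y) v = a x (a y v)"
begin

abbreviation "Z \<equiv> cocycles1 G N V a"
abbreviation "rel \<equiv> cohom_rel1 G N V a"

definition conj_op :: "'a \<Rightarrow> ('a \<Rightarrow> 'i \<Rightarrow> complex) \<Rightarrow> 'a \<Rightarrow> 'i \<Rightarrow> complex" where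
  "conj_op p f = (\<lambda>n\<in>N. a (inv p) (f (p \<otimes> n \<otimes> inv p)))"

definition scale_op :: "complex \<Rightarrow> ('a \<Rightarrow> 'i \<Rightarrow> complex) \<Rightarrow> 'a \<Rightarrow> 'i \<Rightarrow> complex" where
  "scale_op z f = (\<lambda>x\<in>N. \<lambda>i. z * f x i)"

definition lincomb :: "('k :: finite \<Rightarrow> complex) \<Rightarrow> ('k \<Rightarrow> 'a \<Rightarrow> 'i \<Rightarrow> complex) \<Rightarrow> 'a \<Rightarrow> 'i \<Rightarrow> complex" where
  "lincomb c f = (\<lambda>x\<in>N. \<lambda>i. \<Sum>k\<in>UNIV. c k * f k x i)"

definition normalizing :: "'a \<Rightarrow> bool" where
  "normalizing p \<longleftrightarrow> p \<in> carrier G \<and> (\<forall>n\<in>N. p \<otimes> n \<otimes> inv p \<in> N)"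

lemma N_carrier: "x \<in> N \<Longrightarrow> x \<in> carrier G"
  and N_mult: "x \<in> N \<Longrightarrow> y \<in> N \<Longrightarrow> x \<otimes> y \<in> N"
  using N by (auto simp: subgroup.mem_carrier subgroup.m_closed)

lemma V_uminus: "v \<in> V \<Longrightarrow> - v \<in> V"
  using V_scale[of v "- 1"] by (simp add: fun_Compl_def)

lemma a_uminus: "x \<in> carrier G \<Longrightarrow> v \<in> V \<Longrightarrow> a x (- v) = - a x v"
  using a_scale[of x v "- 1"] by (simp add: fun_Compl_def)

lemma a_diff: "x \<in> carrier G \<Longrightarrow> v \<in> V \<Longrightarrow> w \<in> V \<Longrightarrow> a x (v - w) = a x v - a x w"
  using a_add[of x v "- w"] V_uminus[of w] a_uminus[of x w] by simp

lemma a_zero: "x \<in> carrier G \<Longrightarrow> a x 0 = 0"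
  using a_diff[of x 0 0] V_zero by simp

lemma
  fixes K :: "'k set"
  assumes "finite K" and w: "\<And>k. k \<in> K \<Longrightarrow> w k \<in> V"
  shows V_sum: "(\<lambda>i. \<Sum>k\<in>K. c k * w k i) \<in> V"
    and a_sum: "x \<in> carrier G \<Longrightarrow>
      a x (\<lambda>i. \<Sum>k\<in>K. c k * w k i) = (\<lambda>i. \<Sum>k\<in>K. c k * a x (w k) i)"
proof -
  have "(\<lambda>i. \<Sum>k\<in>K. c k * w k i) \<in> V \<and> (x \<in> carrier G \<longrightarrow>
      a x (\<lambda>i. \<Sum>k\<in>K. c k * w k i) = (\<lambda>i. \<Sum>k\<in>K. c k * a x (w k) i))" for x
    using assms
  proof (induction K)
    case empty
    then show ?case using V_zero a_zero by (simp add: zero_fun_def)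
  next
    case (insert k K)
    have split: "(\<lambda>i. \<Sum>k\<in>insert k K. u k i) = u k + (\<lambda>i. \<Sum>k\<in>K. u k i)"
      for u :: "'k \<Rightarrow> 'i \<Rightarrow> complex"
      using insert.hyps by (simp add: fun_eq_iff)
    have V: "(\<lambda>i. c k * w k i) \<in> V" "(\<lambda>i. \<Sum>k\<in>K. c k * w k i) \<in> V"
      using insert by (auto intro: V_scale)
    show ?case
      unfolding split using insert V by (simp add: V_add a_add[OF _ V] a_scale fun_eq_iff)
  qed
  then show "(\<lambda>i. \<Sum>k\<in>K. c k * w k i) \<in> V" "x \<in> carrier G \<Longrightarrow>
      a x (\<lambda>i. \<Sum>k\<in>K. c k * w k i) = (\<lambda>i. \<Sum>k\<in>K. c k * a x (w k) i)"
    by auto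
qed

lemma Z_iff: "f \<in> Z \<longleftrightarrow> (\<forall>x\<in>N. f x \<in> V) \<and> f \<in> extensional N
    \<and> (\<forall>x\<in>N. \<forall>y\<in>N. f (x \<otimes> y) = f x + a x (f y))"
  by (auto simp: cocycles1_def PiE_def)

lemma Z_closed: "f \<in> Z \<Longrightarrow> x \<in> N \<Longrightarrow> f x \<in> V"
  and Z_mult: "f \<in> Z \<Longrightarrow> x \<in> N \<Longrightarrow> y \<in> N \<Longrightarrow> f (x \<otimes> y) = f x + a x (f y)"
  by (simp_all add: Z_iff)

lemma zero_Z: "(\<lambda>x\<in>N. 0) \<in> Z"
  by (auto simp: Z_iff V_zero a_zero N_carrier N_mult)

lemma lincomb_Z:
  assumes "\<And>k. f k \<in> Z"
  shows "lincomb c f \<in> Z"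
proof -
  note Z = Z_closed[OF assms] Z_mult[OF assms]
  have "lincomb c f (x \<otimes> y) = lincomb c f x + a x (lincomb c f y)" if "x \<in> N" "y \<in> N" for x y
    using that
    by (simp add: lincomb_def N_mult N_carrier Z a_sum distrib_left sum.distrib fun_eq_iff)
  then show ?thesis
    by (auto simp: Z_iff) (auto simp: lincomb_def Z V_sum)
qed

lemma scale_op_Z: "f \<in> Z \<Longrightarrow> scale_op z f \<in> Z"
  using lincomb_Z[of "\<lambda>_ :: unit. f" "\<lambda>_. z"] by (simp add: lincomb_def scale_op_def UNIV_unit)

lemma rel_iff: "(f, h) \<in> rel \<longleftrightarrow> f \<in> Z \<and> h \<in> Z \<and> (\<exists>v\<in>V. \<forall>x\<in>N. f x - h x = a x v - v)"
proof -
  have "(\<lambda>x\<in>N. f x - h x) = (\<lambda>x\<in>N. a x v - v) \<longleftrightarrow> (\<forall>x\<in>N. f x - h x = a x v - v)" for v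
  proof (intro iffI ballI)
    fix x assume eq: "(\<lambda>x\<in>N. f x - h x) = (\<lambda>x\<in>N. a x v - v)" and x: "x \<in> N"
    show "f x - h x = a x v - v"
      using fun_cong[OF eq, of x] unfolding restrict_apply'[OF x] .
  qed (auto intro: restrict_ext)
  then show ?thesis unfolding cohom_rel1_def coboundaries1_def by auto
qed

lemma relI: "f \<in> Z \<Longrightarrow> h \<in> Z \<Longrightarrow> v \<in> V \<Longrightarrow> (\<And>x. x \<in> N \<Longrightarrow> f x - h x = a x v - v) \<Longrightarrow> (f, h) \<in> rel"
  unfolding rel_iff by blast

lemma relE:
  assumes "(f, h) \<in> rel"
  obtains v where "f \<in> Z" "h \<in> Z" "v \<in> V" "\<And>x. x \<in> N \<Longrightarrow> f x - h x = a x v - v"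
  using assms unfolding rel_iff by blast

lemma rel_equiv: "equiv Z rel"
proof (rule equivI)
  show "rel \<subseteq> Z \<times> Z" by (auto simp: rel_iff)
  show "refl_on Z rel"
    by (rule refl_onI) (auto intro!: relI[OF _ _ V_zero] simp: a_zero N_carrier)
  show "sym rel"
  proof (rule symI)
    fix f h assume "(f, h) \<in> rel"
    then obtain v where v: "f \<in> Z" "h \<in> Z" "v \<in> V" "\<And>x. x \<in> N \<Longrightarrow> f x - h x = a x v - v"
      by (rule relE) blast
    show "(h, f) \<in> rel"
    proof (rule relI[OF v(2,1) V_uminus[OF v(3)]])
      fix x assume "x \<in> N"
      then show "h x - f x = a x (- v) - - v"
        using v(4)[of x] a_uminus[OF N_carrier v(3), of x] by (simp add: algebra_simps)
    qed
  qed
  show "trans rel"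
  proof (rule transI)
    fix f h k assume "(f, h) \<in> rel"
    then obtain v where v: "f \<in> Z" "h \<in> Z" "v \<in> V" "\<And>x. x \<in> N \<Longrightarrow> f x - h x = a x v - v"
      by (rule relE) blast
    assume "(h, k) \<in> rel"
    then obtain w where w: "h \<in> Z" "k \<in> Z" "w \<in> V" "\<And>x. x \<in> N \<Longrightarrow> h x - k x = a x w - w"
      by (rule relE) blast
    show "(f, k) \<in> rel"
    proof (rule relI[OF v(1) w(2) V_add[OF v(3) w(3)]])
      fix x assume x: "x \<in> N"
      have "f x - k x = (f x - h x) + (h x - k x)" by simp
      also have "\<dots> = a x (v + w) - (v + w)"
        using v(3,4) w(3,4) x by (simp add: a_add N_carrier)
      finally show "f x - k x = a x (v + w) - (v + w)" .
    qed
  qed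
qed

lemma class_eq_iff: "f \<in> Z \<Longrightarrow> h \<in> Z \<Longrightarrow> rel `` {f} = rel `` {h} \<longleftrightarrow> (f, h) \<in> rel"
  by (rule eq_equiv_class_iff[OF rel_equiv])

lemma class_in_H1: "f \<in> Z \<Longrightarrow> rel `` {f} \<in> H1 G N V a"
  unfolding H1_def by (rule quotientI)

lemma scale_op_rel:
  assumes "(f, h) \<in> rel"
  shows "(scale_op z f, scale_op z h) \<in> rel"
proof -
  obtain v where v: "f \<in> Z" "h \<in> Z" "v \<in> V" "\<And>x. x \<in> N \<Longrightarrow> f x - h x = a x v - v"
    using assms by (rule relE) blast
  show ?thesis
  proof (rule relI[OF scale_op_Z[OF v(1)] scale_op_Z[OF v(2)] V_scale[OF v(3), of z]])
    fix x assume x: "x \<in> N"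
    have "f x i - h x i = a x v i - v i" for i using fun_cong[OF v(4)[OF x], of i] by simp
    then show "scale_op z f x - scale_op z h x = a x (\<lambda>i. z * v i) - (\<lambda>i. z * v i)"
      using x by (simp add: scale_op_def a_scale N_carrier v(3) fun_eq_iff flip: right_diff_distrib)
  qed
qed

lemma group_conj_mult:
  assumes "p \<in> carrier G" "x \<in> carrier G" "y \<in> carrier G"
  shows "p \<otimes> (x \<otimes> y) \<otimes> inv p = (p \<otimes> x \<otimes> inv p) \<otimes> (p \<otimes> y \<otimes> inv p)"
proof -
  have "inv p \<otimes> (p \<otimes> z) = z" if "z \<in> carrier G" for z
    using assms(1) that by (simp flip: m_assoc)
  then show ?thesis using assms by (simp add: m_assoc)
qed

lemma a_inv_conj:
  assumes "p \<in> carrier G" "x \<in> carrier G" "v \<in> V"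
  shows "a (inv p) (a (p \<otimes> x \<otimes> inv p) v) = a x (a (inv p) v)"
proof -
  have "inv p \<otimes> (p \<otimes> x \<otimes> inv p) = x \<otimes> inv p"
    using assms(1,2) by (simp flip: m_assoc)
  then show ?thesis using assms by (simp flip: a_mult)
qed

lemma normalizingD:
  assumes "normalizing p"
  shows "p \<in> carrier G" "inv p \<in> carrier G" "x \<in> N \<Longrightarrow> p \<otimes> x \<otimes> inv p \<in> N"
  using assms by (auto simp: normalizing_def)

lemma conj_op_Z:
  assumes p: "normalizing p" and f: "f \<in> Z"
  shows "conj_op p f \<in> Z"
proof -
  note p_closed = normalizingD(1,2)[OF p] and conj_N = normalizingD(3)[OF p]
  have "conj_op p f (x \<otimes> y) = conj_op p f x + a x (conj_op p f y)" if xy: "x \<in> N" "y \<in> N" for x y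
  proof -
    let ?x = "p \<otimes> x \<otimes> inv p" and ?y = "p \<otimes> y \<otimes> inv p"
    have "conj_op p f (x \<otimes> y) = a (inv p) (f (?x \<otimes> ?y))"
      using xy by (simp add: conj_op_def N_mult group_conj_mult[OF p_closed(1)] N_carrier)
    also have "\<dots> = a (inv p) (f ?x) + a (inv p) (a ?x (f ?y))"
      using xy by (simp add: Z_mult[OF f] conj_N Z_closed[OF f] a_add[OF p_closed(2)] a_closed N_carrier)
    also have "a (inv p) (a ?x (f ?y)) = a x (a (inv p) (f ?y))"
      using xy by (simp add: a_inv_conj[OF p_closed(1)] N_carrier conj_N Z_closed[OF f])
    also have "a (inv p) (f ?x) + a x (a (inv p) (f ?y)) = conj_op p f x + a x (conj_op p f y)"
      using xy by (simp add: conj_op_def)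
    finally show ?thesis .
  qed
  then show ?thesis
    by (auto simp: Z_iff) (auto simp: conj_op_def a_closed p_closed conj_N Z_closed[OF f])
qed

lemma conj_op_rel:
  assumes p: "normalizing p" and "(f, h) \<in> rel"
  shows "(conj_op p f, conj_op p h) \<in> rel"
proof -
  obtain v where v: "f \<in> Z" "h \<in> Z" "v \<in> V" "\<And>x. x \<in> N \<Longrightarrow> f x - h x = a x v - v"
    using assms(2) by (rule relE) blast
  note p_closed = normalizingD(1,2)[OF p] and conj_N = normalizingD(3)[OF p]
  show ?thesis
  proof (rule relI[OF conj_op_Z[OF p v(1)] conj_op_Z[OF p v(2)] a_closed[OF p_closed(2) v(3)]])
    fix x assume x: "x \<in> N"
    let ?x = "p \<otimes> x \<otimes> inv p"
    have "conj_op p f x - conj_op p h x = a (inv p) (f ?x - h ?x)"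
      using x p_closed conj_N v(1,2) by (simp add: conj_op_def a_diff Z_closed)
    also have "\<dots> = a (inv p) (a ?x v) - a (inv p) v"
      using x p_closed conj_N v(3,4) by (simp add: a_diff a_closed N_carrier)
    also have "a (inv p) (a ?x v) = a x (a (inv p) v)"
      using x p_closed v(3) by (simp add: a_inv_conj N_carrier)
    finally show "conj_op p f x - conj_op p h x = a x (a (inv p) v) - a (inv p) v" .
  qed
qed

lemma H1_act_class:
  assumes p: "normalizing p" and f: "f \<in> Z"
  shows "H1_act G N V a p (rel `` {f}) = rel `` {conj_op p f}"
proof -
  have "(\<lambda>f. rel `` {conj_op p f}) respects rel"
    by (rule congruentI) (metis conj_op_rel[OF p] equiv_class_eq[OF rel_equiv])
  from UN_equiv_class[OF rel_equiv this f] show ?thesis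
    unfolding H1_act_def conj_op_def .
qed

lemma H1_scale_class:
  assumes f: "f \<in> Z"
  shows "H1_scale G N V a z (rel `` {f}) = rel `` {scale_op z f}"
proof -
  have "(\<lambda>f. rel `` {scale_op z f}) respects rel"
    by (rule congruentI) (metis scale_op_rel equiv_class_eq[OF rel_equiv])
  from UN_equiv_class[OF rel_equiv this f] show ?thesis
    unfolding H1_scale_def scale_op_def .
qed

lemma H1_act_zero:
  assumes "normalizing p"
  shows "H1_act G N V a p (H1_zero G N V a) = H1_zero G N V a"
proof -
  have "conj_op p (\<lambda>x\<in>N. 0) = (\<lambda>x\<in>N. 0)"
    using assms by (auto simp: conj_op_def normalizing_def a_zero fun_eq_iff restrict_def)
  then show ?thesis
    unfolding H1_zero_def H1_act_class[OF assms zero_Z] by simp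
qed

end

locale H1_eigenbasis = H1_module G N V a
  for G (structure) and N V and a :: "'a \<Rightarrow> ('i \<Rightarrow> complex) \<Rightarrow> 'i \<Rightarrow> complex" +
  fixes p and f :: "'k :: finite \<Rightarrow> 'a \<Rightarrow> 'i \<Rightarrow> complex" and \<mu> :: "'k \<Rightarrow> complex"
  assumes p: "normalizing p"
    and f_Z: "f k \<in> Z"
    and conj_op_f: "conj_op p (f k) = scale_op (\<mu> k) (f k)"
    and spanning: "h \<in> Z \<Longrightarrow> \<exists>c. (h, lincomb c f) \<in> rel"
    and independent: "(lincomb c f, \<lambda>x\<in>N. 0) \<in> rel \<Longrightarrow> c = (\<lambda>_. 0)"
begin

abbreviation "class c \<equiv> rel `` {lincomb c f}"

lemma lincomb_f_Z: "lincomb c f \<in> Z"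
  by (intro lincomb_Z f_Z)

lemma class_cases:
  assumes "X \<in> H1 G N V a"
  obtains c where "X = class c"
proof -
  obtain h where h: "h \<in> Z" "X = rel `` {h}"
    using assms unfolding H1_def by (rule quotientE)
  obtain c where "(h, lincomb c f) \<in> rel" using spanning[OF h(1)] by blast
  then show ?thesis using that class_eq_iff[OF h(1) lincomb_f_Z] h(2) by blast
qed

lemma class_eq_class_iff: "class c = class d \<longleftrightarrow> c = d"
proof
  assume "class c = class d"
  then obtain v where v: "v \<in> V" "\<And>x. x \<in> N \<Longrightarrow> lincomb c f x - lincomb d f x = a x v - v"
    unfolding class_eq_iff[OF lincomb_f_Z lincomb_f_Z] by (elim relE) blast
  have "(lincomb (\<lambda>k. c k - d k) f, \<lambda>x\<in>N. 0) \<in> rel"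
  proof (rule relI[OF lincomb_f_Z zero_Z v(1)])
    fix x assume "x \<in> N"
    then show "lincomb (\<lambda>k. c k - d k) f x - (\<lambda>x\<in>N. 0) x = a x v - v"
      by (simp add: lincomb_def fun_eq_iff left_diff_distrib sum_subtractf flip: v(2))
  qed
  from fun_cong[OF independent[OF this]] show "c = d" by (simp add: fun_eq_iff)
qed simp

lemma class_zero: "class (\<lambda>_. 0) = H1_zero G N V a"
proof -
  have "lincomb (\<lambda>_. 0) f = (\<lambda>x\<in>N. 0)" by (auto simp: lincomb_def restrict_def fun_eq_iff)
  then show ?thesis by (simp add: H1_zero_def)
qed

lemma H1_act_eq_class: "H1_act G N V a p (class c) = class (\<lambda>k. \<mu> k * c k)"
proof -
  have "conj_op p (lincomb c f) x = lincomb (\<lambda>k. \<mu> k * c k) f x" for x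
  proof (cases "x \<in> N")
    case True
    have "a (inv p) (f k (p \<otimes> x \<otimes> inv p)) i = \<mu> k * f k x i" for k i
      using True fun_cong[OF conj_op_f, of k x] by (simp add: conj_op_def scale_op_def)
    then show ?thesis
      using True normalizingD(2,3)[OF p]
      by (simp add: conj_op_def lincomb_def a_sum Z_closed[OF f_Z] mult_ac)
  qed (simp add: conj_op_def lincomb_def)
  then have "conj_op p (lincomb c f) = lincomb (\<lambda>k. \<mu> k * c k) f" ..
  then show ?thesis by (simp add: H1_act_class[OF p lincomb_f_Z])
qed

lemma H1_scale_eq_class: "H1_scale G N V a z (class c) = class (\<lambda>k. z * c k)"
proof -
  have "scale_op z (lincomb c f) = lincomb (\<lambda>k. z * c k) f"
    by (auto simp: scale_op_def lincomb_def restrict_def fun_eq_iff sum_distrib_left mult_ac)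
  then show ?thesis by (simp add: H1_scale_class[OF lincomb_f_Z])
qed

theorem H1_eigenvalues_eq: "H1_eigenvalues G N V a p = range \<mu>"
proof (intro equalityI subsetI)
  fix z assume "z \<in> H1_eigenvalues G N V a p"
  then obtain X where X: "X \<in> H1 G N V a" "X \<noteq> H1_zero G N V a"
    "H1_act G N V a p X = H1_scale G N V a z X"
    by (auto simp: H1_eigenvalues_def)
  obtain c where "X = class c" using class_cases[OF X(1)] .
  with X(2,3) have "c \<noteq> (\<lambda>_. 0)" and eq: "(\<lambda>k. \<mu> k * c k) = (\<lambda>k. z * c k)"
    by (auto simp: H1_act_eq_class H1_scale_eq_class class_eq_class_iff simp flip: class_zero)
  then obtain k where "c k \<noteq> 0" by auto
  with fun_cong[OF eq, of k] show "z \<in> range \<mu>" by auto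
next
  fix z assume "z \<in> range \<mu>"
  then obtain k where z: "z = \<mu> k" by blast
  define c where "c = (\<lambda>k'. if k' = k then 1 else 0 :: complex)"
  have "class c \<noteq> H1_zero G N V a"
    unfolding class_zero[symmetric] class_eq_class_iff by (auto simp: c_def fun_eq_iff)
  moreover have "H1_act G N V a p (class c) = H1_scale G N V a z (class c)"
    unfolding H1_act_eq_class H1_scale_eq_class class_eq_class_iff by (auto simp: c_def z)
  ultimately show "z \<in> H1_eigenvalues G N V a p"
    unfolding H1_eigenvalues_def using class_in_H1[OF lincomb_f_Z] by blast
qed

theorem H1_invariants_eq:
  assumes P: "subgroup P G" "N \<subseteq> P" "p \<in> P" and norm: "\<And>q. q \<in> P \<Longrightarrow> normalizing q"
    and ne: "1 \<notin> range \<mu>"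
  shows "H1_invariants G P N V a = {H1_zero G N V a}"
proof (intro equalityI subsetI)
  fix X assume X: "X \<in> H1_invariants G P N V a"
  then obtain c where c: "X = class c"
    using class_cases by (auto simp: H1_invariants_def)
  have "p \<in> N #>\<^bsub>G\<lparr>carrier := P\<rparr>\<^esub> p"
    using p subgroup.one_closed[OF N] by (auto simp: r_coset_def normalizing_def intro!: bexI[of _ \<one>])
  moreover have "N #>\<^bsub>G\<lparr>carrier := P\<rparr>\<^esub> p \<in> carrier (G\<lparr>carrier := P\<rparr> Mod N)"
    using P(3) by (simp add: carrier_FactGroup)
  ultimately have "H1_act G N V a p X = X"
    using X by (auto simp: H1_invariants_def)
  then have eq: "(\<lambda>k. \<mu> k * c k) = c"
    by (simp add: c H1_act_eq_class class_eq_class_iff)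
  have "c = (\<lambda>_. 0)"
    using fun_cong[OF eq] ne by (metis mult_cancel_right1 rangeI)
  then show "X \<in> {H1_zero G N V a}"
    by (simp add: c flip: class_zero)
next
  fix X assume "X \<in> {H1_zero G N V a}"
  moreover have "normalizing q" if C: "C \<in> carrier (G\<lparr>carrier := P\<rparr> Mod N)" and q: "q \<in> C" for C q
  proof -
    obtain r where r: "r \<in> P" "C = N #>\<^bsub>G\<lparr>carrier := P\<rparr>\<^esub> r"
      using C by (auto simp: carrier_FactGroup)
    then obtain h where h: "h \<in> N" "q = h \<otimes> r"
      using q by (auto simp: r_coset_def)
    have "q \<in> P"
      unfolding h(2) using h(1) r(1) P(2) by (intro subgroup.m_closed[OF P(1)]) auto
    then show ?thesis by (rule norm)
  qed
  ultimately show "X \<in> H1_invariants G P N V a"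
    using H1_act_zero class_in_H1[OF zero_Z, folded H1_zero_def] by (auto simp: H1_invariants_def)
qed

end

section \<open>The groups \<open>P\<close> and \<open>U\<close>\<close>

lemma psl_class_eq: "A \<in> carrier_mat 2 2 \<Longrightarrow> psl_class R A = {A, - A}"
  unfolding psl_class_def pm_one_def r_coset_def SL2_def
  by (auto simp: mat22_one elim!: mat22_cases)

lemma mat22_in_SL2:
  "mat22 a b c d \<in> carrier (SL2 R) \<longleftrightarrow> a \<in> R \<and> b \<in> R \<and> c \<in> R \<and> d \<in> R \<and> a * d - b * c = 1"
  by (auto simp: SL2_def)

lemma SL2_carrier_mat: "A \<in> carrier (SL2 R) \<Longrightarrow> A \<in> carrier_mat 2 2"
  by (simp add: SL2_def)

lemma SL2_cases:
  assumes "A \<in> carrier (SL2 R)"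
  obtains a b c d where "A = mat22 a b c d" "a \<in> R" "b \<in> R" "c \<in> R" "d \<in> R" "a * d - b * c = 1"
  using assms by (auto simp: mat22_in_SL2 intro: mat22_cases[OF SL2_carrier_mat[OF assms]])

lemma SL2_mult: "A \<otimes>\<^bsub>SL2 R\<^esub> B = A * B" and SL2_one: "\<one>\<^bsub>SL2 R\<^esub> = mat22 1 0 0 1"
  by (simp_all add: SL2_def mat22_one)

context real_subring
begin

lemma SL2_mult_closed:
  assumes "A \<in> carrier (SL2 R)" "B \<in> carrier (SL2 R)"
  shows "A * B \<in> carrier (SL2 R)"
proof -
  obtain a b c d where A: "A = mat22 a b c d" "a \<in> R" "b \<in> R" "c \<in> R" "d \<in> R" "a * d - b * c = 1"
    using assms(1) by (rule SL2_cases)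
  obtain a' b' c' d' where B: "B = mat22 a' b' c' d'" "a' \<in> R" "b' \<in> R" "c' \<in> R" "d' \<in> R"
    "a' * d' - b' * c' = 1"
    using assms(2) by (rule SL2_cases)
  have "(a * a' + b * c') * (c * b' + d * d') - (a * b' + b * d') * (c * a' + d * c')
      = (a * d - b * c) * (a' * d' - b' * c')"
    by (simp add: algebra_simps)
  then show ?thesis
    using A B by (simp add: mat22_in_SL2 add_closed mult_closed)
qed

lemma SL2_group: "group (SL2 R)"
proof (rule groupI)
  fix A assume A: "A \<in> carrier (SL2 R)"
  then show "\<one>\<^bsub>SL2 R\<^esub> \<otimes>\<^bsub>SL2 R\<^esub> A = A"
    using left_mult_one_mat[OF SL2_carrier_mat] by (simp add: SL2_mult SL2_one mat22_one)
  obtain a b c d where "A = mat22 a b c d" "a \<in> R" "b \<in> R" "c \<in> R" "d \<in> R" "a * d - b * c = 1"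
    using A by (rule SL2_cases)
  then have "mat22 d (- b) (- c) a \<in> carrier (SL2 R)"
    "mat22 d (- b) (- c) a \<otimes>\<^bsub>SL2 R\<^esub> A = \<one>\<^bsub>SL2 R\<^esub>"
    by (auto simp: mat22_in_SL2 SL2_mult SL2_one uminus_closed algebra_simps)
  then show "\<exists>B\<in>carrier (SL2 R). B \<otimes>\<^bsub>SL2 R\<^esub> A = \<one>\<^bsub>SL2 R\<^esub>" by blast
next
  fix A B C assume "A \<in> carrier (SL2 R)" "B \<in> carrier (SL2 R)" "C \<in> carrier (SL2 R)"
  then show "A \<otimes>\<^bsub>SL2 R\<^esub> B \<otimes>\<^bsub>SL2 R\<^esub> C = A \<otimes>\<^bsub>SL2 R\<^esub> (B \<otimes>\<^bsub>SL2 R\<^esub> C)"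
    unfolding SL2_mult by (intro assoc_mult_mat[of _ 2 2 _ 2 _ 2] SL2_carrier_mat)
qed (simp_all add: SL2_mult SL2_one mat22_in_SL2 SL2_mult_closed zero_closed one_closed)

lemma pm_one_normal: "pm_one \<lhd> SL2 R"
proof -
  interpret SL2: group "SL2 R" by (rule SL2_group)
  have pm: "pm_one = {mat22 1 0 0 1, mat22 (- 1) 0 0 (- 1)}"
    by (simp add: pm_one_def mat22_one)
  have carrier: "mat22 1 0 0 1 \<in> carrier (SL2 R)" "mat22 (- 1) 0 0 (- 1) \<in> carrier (SL2 R)"
    by (auto simp: mat22_in_SL2 zero_closed one_closed uminus_closed)
  have inv: "inv\<^bsub>SL2 R\<^esub> mat22 1 0 0 1 = mat22 1 0 0 1"
    "inv\<^bsub>SL2 R\<^esub> mat22 (- 1) 0 0 (- 1) = mat22 (- 1) 0 0 (- 1)"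
    by (rule SL2.inv_equality, use carrier in \<open>auto simp: SL2_mult SL2_one\<close>)+
  have "subgroup pm_one (SL2 R)"
    by (rule SL2.subgroupI) (use carrier inv in \<open>auto simp: pm SL2_mult\<close>)
  moreover have "pm_one #>\<^bsub>SL2 R\<^esub> A = A <#\<^bsub>SL2 R\<^esub> pm_one" if "A \<in> carrier (SL2 R)" for A
    using that[THEN SL2_carrier_mat]
    by (auto simp: r_coset_def l_coset_def SL2_mult pm elim!: mat22_cases)
  ultimately show ?thesis by (intro SL2.normalI) auto
qed

lemma PSL2_group: "group (PSL2 R)"
  unfolding PSL2_def by (rule normal.factorgroup_is_group[OF pm_one_normal])

lemma psl_class_closed: "A \<in> carrier (SL2 R) \<Longrightarrow> psl_class R A \<in> carrier (PSL2 R)"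
  by (auto simp: PSL2_def psl_class_def carrier_FactGroup)

lemma PSL2_cases:
  assumes "X \<in> carrier (PSL2 R)"
  obtains A where "A \<in> carrier (SL2 R)" "X = psl_class R A"
  using assms by (auto simp: PSL2_def psl_class_def carrier_FactGroup)

lemma psl_class_mult:
  assumes "A \<in> carrier (SL2 R)" "B \<in> carrier (SL2 R)"
  shows "psl_class R A \<otimes>\<^bsub>PSL2 R\<^esub> psl_class R B = psl_class R (A * B)"
  using normal.rcos_sum[OF pm_one_normal assms] by (simp add: PSL2_def psl_class_def SL2_mult)

lemma psl_class_one: "\<one>\<^bsub>PSL2 R\<^esub> = psl_class R (mat22 1 0 0 1)"
  by (simp add: PSL2_def psl_class_eq) (simp add: pm_one_def mat22_one)

end

context real_quadratic
begin

definition P_class :: "real \<Rightarrow> real \<Rightarrow> real mat set" where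
  "P_class x u = psl_class \<O> (mat22 x 0 u (inverse x))"

lemma P_mat_in_SL2: "x \<in> integer_units F \<Longrightarrow> u \<in> \<O> \<Longrightarrow> mat22 x 0 u (inverse x) \<in> carrier (SL2 \<O>)"
  by (simp add: mat22_in_SL2 integer_units_iff integers.zero_closed)

lemma P_class_closed: "x \<in> integer_units F \<Longrightarrow> u \<in> \<O> \<Longrightarrow> P_class x u \<in> carrier (PSL2 \<O>)"
  unfolding P_class_def by (intro integers.psl_class_closed P_mat_in_SL2)

lemma P_class_mult:
  assumes "x \<in> integer_units F" "u \<in> \<O>" "y \<in> integer_units F" "w \<in> \<O>"
  shows "P_class x u \<otimes>\<^bsub>PSL2 \<O>\<^esub> P_class y w = P_class (x * y) (u * y + inverse x * w)"
  using assms by (simp add: P_class_def integers.psl_class_mult P_mat_in_SL2)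

lemma P_class_inv:
  assumes "x \<in> integer_units F" "u \<in> \<O>"
  shows "inv\<^bsub>PSL2 \<O>\<^esub> P_class x u = P_class (inverse x) (- u)"
proof (rule group.inv_equality[OF integers.PSL2_group])
  have "inverse x * x = 1" using assms by (simp add: integer_units_iff)
  then show "P_class (inverse x) (- u) \<otimes>\<^bsub>PSL2 \<O>\<^esub> P_class x u = \<one>\<^bsub>PSL2 \<O>\<^esub>"
    using assms
    by (simp add: P_class_mult integer_units_inverse integers.uminus_closed)
       (simp add: P_class_def integers.psl_class_one mult.commute)
qed (use assms in \<open>simp_all add: P_class_closed integer_units_inverse integers.uminus_closed\<close>)

lemma P_class_conj:
  assumes "x \<in> integer_units F" "u \<in> \<O>" "w \<in> \<O>"
  shows "P_class x u \<otimes>\<^bsub>PSL2 \<O>\<^esub> P_class 1 w \<otimes>\<^bsub>PSL2 \<O>\<^esub> inv\<^bsub>PSL2 \<O>\<^esub> P_class x u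
    = P_class 1 ((inverse x)\<^sup>2 * w)"
proof -
  have "x * inverse x = 1" "inverse x \<in> \<O>" using assms(1) by (simp_all add: integer_units_iff)
  then show ?thesis
    using assms
    by (simp add: P_class_inv P_class_mult integer_units_one integer_units_inverse
      integers.add_closed integers.mult_closed integers.uminus_closed power2_eq_square algebra_simps)
qed

lemma grp_P_eq: "grp_P F = {P_class x u | x u. x \<in> integer_units F \<and> u \<in> \<O>}"
  by (simp add: grp_P_def P_class_def)

lemma grp_U_eq: "grp_U F = P_class 1 ` \<O>"
proof
  show "grp_U F \<subseteq> P_class 1 ` \<O>"
  proof
    fix X assume "X \<in> grp_U F"
    then obtain s u where X: "X = psl_class \<O> (mat22 s 0 u s)" "s = 1 \<or> s = - 1" "u \<in> \<O>"
      by (auto simp: grp_U_def)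
    have "psl_class \<O> (mat22 (- 1) 0 u (- 1)) = P_class 1 (- u)"
      by (auto simp: P_class_def psl_class_eq)
    then show "X \<in> P_class 1 ` \<O>"
      using X integers.uminus_closed by (auto simp: P_class_def)
  qed
  show "P_class 1 ` \<O> \<subseteq> grp_U F" by (auto simp: grp_U_def P_class_def)
qed

lemma P_class_in_grp_U: "u \<in> \<O> \<Longrightarrow> P_class 1 u \<in> grp_U F"
  and ball_grp_U: "(\<forall>X\<in>grp_U F. Q X) \<longleftrightarrow> (\<forall>u\<in>\<O>. Q (P_class 1 u))"
  by (auto simp: grp_U_eq)

lemma grp_P_subgroup: "subgroup (grp_P F) (PSL2 \<O>)"
proof (rule group.subgroupI[OF integers.PSL2_group])
  fix X assume "X \<in> grp_P F"
  then obtain x u where X: "X = P_class x u" "x \<in> integer_units F" "u \<in> \<O>"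
    by (auto simp: grp_P_eq)
  show "inv\<^bsub>PSL2 \<O>\<^esub> X \<in> grp_P F"
    unfolding X(1) P_class_inv[OF X(2,3)] grp_P_eq
    using integer_units_inverse[OF X(2)] integers.uminus_closed[OF X(3)] by blast
  fix Y assume "Y \<in> grp_P F"
  then obtain y w where Y: "Y = P_class y w" "y \<in> integer_units F" "w \<in> \<O>"
    by (auto simp: grp_P_eq)
  have "u * y + inverse x * w \<in> \<O>"
    using X Y by (simp add: integer_units_iff integers.add_closed integers.mult_closed)
  then show "X \<otimes>\<^bsub>PSL2 \<O>\<^esub> Y \<in> grp_P F"
    unfolding X(1) Y(1) P_class_mult[OF X(2,3) Y(2,3)] grp_P_eq
    using integer_units_mult[OF X(2) Y(2)] by blast
qed (use integer_units_one integers.one_closed P_class_closed in \<open>auto simp: grp_P_eq\<close>)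

lemma P_class_1_mult: "u \<in> \<O> \<Longrightarrow> w \<in> \<O> \<Longrightarrow> P_class 1 u \<otimes>\<^bsub>PSL2 \<O>\<^esub> P_class 1 w = P_class 1 (u + w)"
  by (simp add: P_class_mult integer_units_one)

lemma grp_U_subgroup: "subgroup (grp_U F) (PSL2 \<O>)"
  unfolding grp_U_eq
  by (rule group.subgroupI[OF integers.PSL2_group])
     (use integers.zero_closed in \<open>auto simp: P_class_closed P_class_1_mult P_class_inv
       integer_units_one integers.add_closed integers.uminus_closed\<close>)

lemma grp_U_subset_grp_P: "grp_U F \<subseteq> grp_P F"
  using integer_units_one by (auto simp: grp_U_eq grp_P_eq)

lemma elem_t_eq: "elem_t F e = P_class (inverse e) 0"
  by (simp add: elem_t_def P_class_def)

definition U_coord :: "real mat set \<Rightarrow> real" where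
  "U_coord = inv_into \<O> (P_class 1)"

lemma U_coord_P_class: "u \<in> \<O> \<Longrightarrow> U_coord (P_class 1 u) = u"
  unfolding U_coord_def
  by (rule inv_into_f_f) (auto simp: inj_on_def P_class_def psl_class_eq doubleton_eq_iff)

end

section \<open>The coefficient module\<close>

locale quadratic_coefficients = real_quadratic_conjugation +
  fixes m n :: nat
  assumes parity: "[m = n] (mod 2)"
begin

abbreviation "\<rho> \<equiv> rep_V \<sigma> m n"

lemma rep_psl_class:
  assumes "A \<in> carrier (SL2 \<O>)"
  shows "\<rho> (psl_class \<O> A) v = tensor_act (sym_rep m (map_mat complex_of_real A))
     (sym_rep n (map_mat complex_of_real (map_mat \<sigma> A))) v"
proof -
  let ?r = "\<lambda>g. tensor_act (sym_rep m (map_mat complex_of_real g))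
     (sym_rep n (map_mat complex_of_real (map_mat \<sigma> g))) v"
  have neg: "map_mat complex_of_real (- A) = - map_mat complex_of_real A"
    "map_mat complex_of_real (map_mat \<sigma> (- A)) = - map_mat complex_of_real (map_mat \<sigma> A)"
    using assms by (auto simp: conj_uminus integer_in_field elim!: SL2_cases)
  have "even m \<longleftrightarrow> even n" using parity by (auto simp: cong_def even_iff_mod_2_eq_zero)
  then have "(- 1) ^ m * (- 1) ^ n = (1 :: complex)" by (cases "even n") auto
  then have "?r (- A) = ?r A"
    unfolding neg using assms[THEN SL2_carrier_mat] by (simp add: sym_rep_uminus tensor_act_smult)
  then have "?r ` psl_class \<O> A = {?r A}"
    using assms[THEN SL2_carrier_mat] by (simp add: psl_class_eq)
  then show ?thesis by (simp add: rep_V_def)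
qed

lemma rep_P_class_unipotent: "u \<in> \<O> \<Longrightarrow> \<rho> (P_class 1 u) v = unip m n (of_real u) (of_real (\<sigma> u)) v"
  using rep_psl_class[OF P_mat_in_SL2[OF integer_units_one]]
  by (simp add: P_class_def unip_def conj_zero conj_one)

lemma rep_P_class_diagonal:
  "x \<in> integer_units F \<Longrightarrow> \<rho> (P_class x 0) v = torus m n (of_real x) (of_real (\<sigma> x)) v"
  using rep_psl_class[OF P_mat_in_SL2[OF _ integers.zero_closed]]
  by (simp add: P_class_def torus_def conj_zero conj_inverse integer_units_iff integer_in_field)

lemma rep_closed: "X \<in> carrier (PSL2 \<O>) \<Longrightarrow> \<rho> X v \<in> tensor_space m n"
  by (elim integers.PSL2_cases) (auto simp: rep_psl_class SL2_carrier_mat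
      intro!: tensor_act_closed[OF sym_rep_carrier sym_rep_carrier])

lemma rep_add: "X \<in> carrier (PSL2 \<O>) \<Longrightarrow> \<rho> X (v + w) = \<rho> X v + \<rho> X w"
  and rep_scale: "X \<in> carrier (PSL2 \<O>) \<Longrightarrow> \<rho> X (\<lambda>p. z * v p) = (\<lambda>p. z * \<rho> X v p)"
  by (elim integers.PSL2_cases, simp add: rep_psl_class tensor_act_add tensor_act_scale)+

lemma rep_mult:
  assumes "X \<in> carrier (PSL2 \<O>)" "Y \<in> carrier (PSL2 \<O>)"
  shows "\<rho> (X \<otimes>\<^bsub>PSL2 \<O>\<^esub> Y) v = \<rho> X (\<rho> Y v)"
proof -
  obtain A where A: "A \<in> carrier (SL2 \<O>)" "X = psl_class \<O> A"
    using assms(1) by (rule integers.PSL2_cases)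
  obtain B where B: "B \<in> carrier (SL2 \<O>)" "Y = psl_class \<O> B"
    using assms(2) by (rule integers.PSL2_cases)
  have "map_mat complex_of_real (A * B) = map_mat complex_of_real A * map_mat complex_of_real B"
    "map_mat complex_of_real (map_mat \<sigma> (A * B))
      = map_mat complex_of_real (map_mat \<sigma> A) * map_mat complex_of_real (map_mat \<sigma> B)"
    using A(1) B(1)
    by (auto simp: conj_add conj_mult integer_in_field field.mult_closed elim!: SL2_cases)
  then show ?thesis
    using A B SL2_carrier_mat[OF A(1)] SL2_carrier_mat[OF B(1)]
    by (simp add: integers.psl_class_mult rep_psl_class integers.SL2_mult_closed sym_rep_mult
        tensor_act_mult[OF sym_rep_carrier sym_rep_carrier sym_rep_carrier sym_rep_carrier])
qed

sublocale H1_module "PSL2 \<O>" "grp_U F" "tensor_space m n" \<rho>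
  by (intro H1_module.intro H1_module_axioms.intro integers.PSL2_group grp_U_subgroup
      tensor_space_zero tensor_space_add tensor_space_scale rep_closed rep_add rep_scale rep_mult)

lemma normalizing_grp_P:
  assumes "q \<in> grp_P F"
  shows "normalizing q"
proof -
  obtain x u where q: "q = P_class x u" "x \<in> integer_units F" "u \<in> \<O>"
    using assms by (auto simp: grp_P_eq)
  have "(inverse x)\<^sup>2 * w \<in> \<O>" if "w \<in> \<O>" for w
    using q(2) that by (simp add: integer_units_iff integers.mult_closed integers.power_closed)
  then show ?thesis
    using q P_class_closed[OF q(2,3)]
    by (simp add: normalizing_def ball_grp_U P_class_conj P_class_in_grp_U)
qed

definition on_U :: "(real \<Rightarrow> tensor) \<Rightarrow> real mat set \<Rightarrow> tensor" where
  "on_U f = (\<lambda>X\<in>grp_U F. f (U_coord X))"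

lemma on_U_P_class: "u \<in> \<O> \<Longrightarrow> on_U f (P_class 1 u) = f u"
  by (simp add: on_U_def P_class_in_grp_U U_coord_P_class)

lemma on_U_extensional: "on_U f \<in> extensional (grp_U F)"
  by (simp add: on_U_def)

lemma eq_on_UI:
  assumes "h \<in> extensional (grp_U F)" "\<And>u. u \<in> \<O> \<Longrightarrow> h (P_class 1 u) = f u"
  shows "h = on_U f"
  by (rule extensionalityI[OF assms(1) on_U_extensional]) (auto simp: grp_U_eq on_U_P_class assms(2))

lemma scale_op_on_U: "scale_op z (on_U f) = on_U (\<lambda>u p. z * f u p)"
  by (rule eq_on_UI) (simp_all add: scale_op_def P_class_in_grp_U on_U_P_class)

end

section \<open>Eigenvalues on the first cohomology\<close>

locale quadratic_unit = quadratic_coefficients +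
  fixes \<epsilon> :: real
  assumes unit: "\<epsilon> \<in> integer_units F" and gt_1: "\<epsilon> > 1"
begin

lemma unit_integer: "\<epsilon> \<in> \<O>"
  using unit by (simp add: integer_units_iff)

lemma unit_irrational: "\<epsilon> \<notin> \<rat>"
  using abs_rational_unit[OF unit] gt_1 by auto

lemma unit_nonzero: "\<epsilon> \<noteq> 0" and conj_unit_nonzero: "\<sigma> \<epsilon> \<noteq> 0"
  using unit conj_unit[OF unit] by (auto simp: integer_units_iff)

lemma abs_conj_unit: "\<bar>\<sigma> \<epsilon>\<bar> = inverse \<epsilon>"
  using abs_norm_unit[OF unit] gt_1 by (simp add: abs_mult field_simps)

sublocale U: unipotent_module \<O> complex_of_real "\<lambda>x. of_real (\<sigma> x)" m n
proof
  show "\<exists>\<alpha> \<beta>. \<forall>x\<in>\<O>. f x = \<alpha> * of_real x + \<beta> * of_real (\<sigma> x)"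
    if "additive_on \<O> f" for f :: "real \<Rightarrow> complex"
    using additive_on_integers_eq_conj_combination[OF that unit_integer unit_irrational] by metis
  show "\<alpha> = 0 \<and> \<beta> = 0" if "\<And>x. x \<in> \<O> \<Longrightarrow> \<alpha> * of_real x + \<beta> * of_real (\<sigma> x) = 0" for \<alpha> \<beta> :: complex
    using conj_combination_eq_0[OF unit_integer unit_irrational that] .
qed (simp_all add: additive_on_def integers.add_closed conj_add integer_in_field)

lemma rep_eq_act: "u \<in> \<O> \<Longrightarrow> \<rho> (P_class 1 u) v = U.act u v"
  by (simp add: rep_P_class_unipotent U.act_def)

lemma on_U_Z: "U.cocycle f \<Longrightarrow> on_U f \<in> Z"
  unfolding Z_iff ball_grp_U
  by (simp add: on_U_P_class P_class_1_mult rep_eq_act integers.add_closed U.cocycle_closed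
      U.cocycle_eq on_U_extensional fun_eq_iff)

lemma Z_imp_cocycle: "h \<in> Z \<Longrightarrow> U.cocycle (\<lambda>u. h (P_class 1 u))"
  unfolding Z_iff ball_grp_U U.cocycle_def by (simp add: rep_eq_act P_class_1_mult)

lemma elem_t_in_grp_P: "elem_t F \<epsilon> \<in> grp_P F"
  unfolding elem_t_eq grp_P_eq using integer_units_inverse[OF unit] integers.zero_closed by blast

lemma conj_op_elem_t_on_U:
  "conj_op (elem_t F \<epsilon>) (on_U f) = on_U (\<lambda>u. torus m n (of_real \<epsilon>) (of_real (\<sigma> \<epsilon>)) (f (\<epsilon>\<^sup>2 * u)))"
proof (rule eq_on_UI)
  fix u assume u: "u \<in> \<O>"
  have "\<epsilon>\<^sup>2 * u \<in> \<O>"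
    by (intro integers.mult_closed integers.power_closed unit_integer u)
  moreover have "elem_t F \<epsilon> \<otimes>\<^bsub>PSL2 \<O>\<^esub> P_class 1 u \<otimes>\<^bsub>PSL2 \<O>\<^esub> inv\<^bsub>PSL2 \<O>\<^esub> elem_t F \<epsilon>
      = P_class 1 (\<epsilon>\<^sup>2 * u)"
    using P_class_conj[OF integer_units_inverse[OF unit] integers.zero_closed u]
    by (simp add: elem_t_eq)
  moreover have "inv\<^bsub>PSL2 \<O>\<^esub> elem_t F \<epsilon> = P_class \<epsilon> 0"
    using P_class_inv[OF integer_units_inverse[OF unit] integers.zero_closed]
    by (simp add: elem_t_eq)
  ultimately show "conj_op (elem_t F \<epsilon>) (on_U f) (P_class 1 u)
      = torus m n (of_real \<epsilon>) (of_real (\<sigma> \<epsilon>)) (f (\<epsilon>\<^sup>2 * u))"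
    using u by (simp add: conj_op_def P_class_in_grp_U on_U_P_class rep_P_class_diagonal[OF unit])
qed (simp add: conj_op_def)

definition eigencocycle :: "bool \<Rightarrow> real mat set \<Rightarrow> tensor" where
  "eigencocycle b = on_U (if b then U.cocycle_X else U.cocycle_Y)"

definition eigenval :: "bool \<Rightarrow> real" where
  "eigenval b = (if b then \<epsilon> ^ (m + 2) * inverse (\<sigma> \<epsilon>) ^ n else \<sigma> \<epsilon> ^ (n + 2) * inverse \<epsilon> ^ m)"

lemma conj_op_eigencocycle:
  "conj_op (elem_t F \<epsilon>) (eigencocycle b) = scale_op (of_real (eigenval b)) (eigencocycle b)"
proof -
  let ?T = "torus m n (of_real \<epsilon>) (of_real (\<sigma> \<epsilon>))"
  have X: "?T (U.cocycle_X (\<epsilon>\<^sup>2 * u)) = (\<lambda>p. of_real (eigenval True) * U.cocycle_X u p)" for u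
    using torus_edge_integral[of "of_real \<epsilon>" m n "of_real (\<sigma> \<epsilon>)" "of_real u"] unit_nonzero
    by (simp add: U.cocycle_X_def eigenval_def)
  have Y: "?T (U.cocycle_Y (\<epsilon>\<^sup>2 * u)) = (\<lambda>p. of_real (eigenval False) * U.cocycle_Y u p)"
    if "u \<in> \<O>" for u
  proof -
    have "u \<in> F" "\<epsilon> \<in> F" using that unit_integer by (auto intro: integer_in_field)
    then have "\<sigma> (\<epsilon>\<^sup>2 * u) = (\<sigma> \<epsilon>)\<^sup>2 * \<sigma> u"
      by (simp add: power2_eq_square conj_mult field.mult_closed)
    then show ?thesis
      using torus_edge_integral[of "of_real (\<sigma> \<epsilon>)" n m "of_real \<epsilon>" "of_real (\<sigma> u)"] conj_unit_nonzero
      by (simp add: U.cocycle_Y_def torus_swap eigenval_def fun_eq_iff)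
  qed
  show ?thesis
    unfolding eigencocycle_def conj_op_elem_t_on_U scale_op_on_U
    by (rule eq_on_UI) (auto simp: on_U_def P_class_in_grp_U U_coord_P_class X Y)
qed

lemma eigenval_eq_powi:
  "eigenval True = \<epsilon> powi (int m + 2) * \<sigma> \<epsilon> powi (- int n)"
  "eigenval False = \<epsilon> powi (- int m - 2) * \<sigma> \<epsilon> powi (int n)"
proof -
  have exponents: "int m + 2 = int (m + 2)" "- int m - 2 = - int (m + 2)" by simp_all
  show "eigenval True = \<epsilon> powi (int m + 2) * \<sigma> \<epsilon> powi (- int n)"
    by (simp only: exponents eigenval_def if_True power_int_of_nat power_int_minus power_inverse)
  have "(\<epsilon> * \<sigma> \<epsilon>)\<^sup>2 = 1" using abs_norm_unit[OF unit] by (metis power2_abs one_power2)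
  then have "(\<sigma> \<epsilon>)\<^sup>2 = (inverse \<epsilon>)\<^sup>2"
    using unit_nonzero by (simp add: power_mult_distrib field_simps)
  then have "eigenval False = inverse \<epsilon> ^ (m + 2) * \<sigma> \<epsilon> ^ n"
    by (simp only: eigenval_def if_False power_add mult_ac)
  then show "eigenval False = \<epsilon> powi (- int m - 2) * \<sigma> \<epsilon> powi (int n)"
    by (simp only: exponents power_int_of_nat power_int_minus power_inverse)
qed

lemma eigenval_neq_1: "eigenval b \<noteq> 1"
proof (cases b)
  case True
  have "\<bar>eigenval True\<bar> = \<epsilon> ^ (m + 2 + n)"
    using gt_1 by (simp add: eigenval_def abs_mult power_abs abs_conj_unit power_add)
  also have "\<dots> > 1" using gt_1 by (intro one_less_power) auto
  finally show ?thesis using True by auto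
next
  case False
  have "\<bar>eigenval False\<bar> = inverse \<epsilon> ^ (n + 2 + m)"
    using gt_1 by (simp add: eigenval_def abs_mult power_abs abs_conj_unit power_add)
  also have "\<dots> < 1" 
    using one_less_power[OF gt_1, of "n + 2 + m"]
    by (simp only: power_inverse inverse_less_1_iff) simp
  finally show ?thesis using False by auto
qed

lemma std_cocycle_eq_lincomb:
  assumes "u \<in> \<O>"
  shows "U.std_cocycle v (c True) (c False) u =
    (U.act u v - v) + lincomb c eigencocycle (P_class 1 u)"
  using assms
  by (simp add: U.std_cocycle_def lincomb_def eigencocycle_def on_U_P_class P_class_in_grp_U
      UNIV_bool fun_eq_iff)

lemma eigencocycle_Z: "eigencocycle b \<in> Z"
  by (simp add: eigencocycle_def on_U_Z U.cocycle_cocycle_X U.cocycle_cocycle_Y)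

lemma eigencocycles_span:
  assumes h: "h \<in> Z"
  obtains c where "(h, lincomb c eigencocycle) \<in> rel"
proof -
  obtain v \<alpha> \<beta> where v: "v \<in> tensor_space m n"
    and h_eq: "\<And>u. u \<in> \<O> \<Longrightarrow> h (P_class 1 u) = U.std_cocycle v \<alpha> \<beta> u"
    using U.cocycle_eq_std_cocycle[OF Z_imp_cocycle[OF h]] by blast
  define c where "c b = (if b then \<alpha> else \<beta>)" for b
  have "(h, lincomb c eigencocycle) \<in> rel"
  proof (rule relI[OF h lincomb_Z[OF eigencocycle_Z] v])
    fix X assume "X \<in> grp_U F"
    then obtain u where u: "X = P_class 1 u" "u \<in> \<O>" by (auto simp: grp_U_eq)
    then show "h X - lincomb c eigencocycle X = \<rho> X v - v"
      using h_eq[OF u(2)] std_cocycle_eq_lincomb[OF u(2), of v c] by (simp add: c_def rep_eq_act)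
  qed
  then show ?thesis by (rule that)
qed

lemma eigencocycles_independent:
  assumes "(lincomb c eigencocycle, \<lambda>X\<in>grp_U F. 0) \<in> rel"
  shows "c = (\<lambda>_. 0)"
proof -
  obtain v where v: "\<And>X. X \<in> grp_U F \<Longrightarrow>
      lincomb c eigencocycle X - (\<lambda>X\<in>grp_U F. 0) X = \<rho> X v - v"
    using assms by (rule relE) blast
  have "U.std_cocycle (- v) (c True) (c False) u = 0" if "u \<in> \<O>" for u
  proof -
    have "lincomb c eigencocycle (P_class 1 u) = U.act u v - v"
      using v[OF P_class_in_grp_U[OF that]] that by (simp add: P_class_in_grp_U rep_eq_act)
    moreover have "U.act u (- v) = - U.act u v"
      using U.act_diff[of u 0 v] U.act_diff[of u 0 0] by simp
    ultimately show ?thesis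
      using std_cocycle_eq_lincomb[OF that, of "- v" c] by simp
  qed
  then have "c True = 0 \<and> c False = 0" by (rule U.std_cocycle_eq_0_imp_coeffs_eq_0)
  then have "c b = 0" for b by (cases b) simp_all
  then show ?thesis by (rule ext)
qed

sublocale H1_eigenbasis "PSL2 \<O>" "grp_U F" "tensor_space m n" \<rho> "elem_t F \<epsilon>" eigencocycle
  "\<lambda>b. of_real (eigenval b)"
  by (intro H1_eigenbasis.intro H1_eigenbasis_axioms.intro H1_module_axioms
      normalizing_grp_P elem_t_in_grp_P eigencocycle_Z conj_op_eigencocycle
      eigencocycles_independent)
     (meson eigencocycles_span)

lemma H1_eigenvalues_elem_t:
  "H1_eigenvalues (PSL2 \<O>) (grp_U F) (tensor_space m n) \<rho> (elem_t F \<epsilon>) =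
    {complex_of_real (\<epsilon> powi (int m + 2) * \<sigma> \<epsilon> powi (- int n)),
     complex_of_real (\<epsilon> powi (- int m - 2) * \<sigma> \<epsilon> powi (int n))}"
  unfolding H1_eigenvalues_eq UNIV_bool eigenval_eq_powi[symmetric] by auto

lemma H1_invariants_grp_P:
  "H1_invariants (PSL2 \<O>) (grp_P F) (grp_U F) (tensor_space m n) \<rho>
    = {H1_zero (PSL2 \<O>) (grp_U F) (tensor_space m n) \<rho>}"
proof (rule H1_invariants_eq[OF grp_P_subgroup grp_U_subset_grp_P elem_t_in_grp_P normalizing_grp_P])
  have "of_real (eigenval b) \<noteq> (1 :: complex)" for b
    using eigenval_neq_1 by simp
  then show "1 \<notin> range (\<lambda>b. complex_of_real (eigenval b))"
    by (metis rangeE)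
qed

end

theorem theorem3p6:
  fixes F :: "real set" and \<sigma> :: "real \<Rightarrow> real" and \<epsilon> :: real and l\<^sub>1 l\<^sub>2 :: nat
  assumes "real_quadratic_field F"
    and "galois_conjugation F \<sigma>"
    and "fundamental_unit F \<epsilon>"
    and "l\<^sub>1 \<ge> l\<^sub>2" and "[l\<^sub>1 = l\<^sub>2] (mod 2)"
  shows "H1_eigenvalues (PSL2 (ring_of_integers F)) (grp_U F) (tensor_space l\<^sub>1 l\<^sub>2)
           (rep_V \<sigma> l\<^sub>1 l\<^sub>2) (elem_t F \<epsilon>)
         = {complex_of_real (\<epsilon> powi (int l\<^sub>1 + 2) * \<sigma> \<epsilon> powi (- int l\<^sub>2)),
            complex_of_real (\<epsilon> powi (- int l\<^sub>1 - 2) * \<sigma> \<epsilon> powi (int l\<^sub>2))}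
       \<and> H1_invariants (PSL2 (ring_of_integers F)) (grp_P F) (grp_U F) (tensor_space l\<^sub>1 l\<^sub>2)
           (rep_V \<sigma> l\<^sub>1 l\<^sub>2)
         = {H1_zero (PSL2 (ring_of_integers F)) (grp_U F) (tensor_space l\<^sub>1 l\<^sub>2)
           (rep_V \<sigma> l\<^sub>1 l\<^sub>2)}"
proof -
  interpret quadratic_unit F \<sigma> l\<^sub>1 l\<^sub>2 \<epsilon>
    using assms by unfold_locales (auto simp: fundamental_unit_def)
  show ?thesis
    using H1_eigenvalues_elem_t H1_invariants_grp_P by (rule conjI)
qed

end
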